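(* Let $\mathcal H_1$ be a finite dimensional complex Hilbert space with a CAR field acting irreducibly on $\mathscr K$. There exist quantum operations on $\mathscr A_{\mathcal H_1}$ that map $\mathfrak S_{GIG}$ into itself and whose symbol maps $\mathscr Q\to\mathscr Q$ are not affine.
   Context: Let $N$ denote the dimension of $\mathcal H_1$. Inner products are conjugate linear in the first variable. A CAR field over $\mathcal H_1$ is a conjugate linear map $\psi\mapsto Z(\psi)$ from $\mathcal H_1$ into the bounded operators on a Hilbert space $\mathscr K$ such that, with $Z^*(\psi):=Z(\psi)^*$, $Z(\psi)Z^*(\phi)+Z^*(\phi)Z(\psi)=\langle\psi,\phi\rangle 1$ and $Z(\psi)Z(\phi)+Z(\phi)Z(\psi)=0$ for all $\psi,\phi\in\mathcal H_1$. When $Z$ acts irreducibly, $\dim\mathscr K=2^N$ and the $*$-algebra $\mathscr A_{\mathcal H_1}$ generated by the $Z(\psi)$ is $\mathcal B(\mathscr K)$. The normalized trace is $\tau(A)=2^{-N}\mathrm{Tr}[A]$; density matrices are operators $\rho\ge0$ with $\tau(\rho)=1$. A quantum operation is a completely positive trace preserving linear map (acting on density matrices). Let $\mathscr Q=\{Q\in\mathcal B(\mathcal H_1): 0\le Q\le 1\}$. For $Q\in\mathscr Q$ with spectral decomposition $Q=\sum_{j=1}^N\mu_j|\psi_j\rangle\langle\psi_j|$, put $\rho_Q=\prod_{j=1}^N\big((1-\mu_j)2Z(\psi_j)Z^*(\psi_j)+\mu_j2Z^*(\psi_j)Z(\psi_j)\big)$, the density matrix of the gauge invariant Gaussian state with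 symbol $Q$; $\mathfrak S_{GIG}=\{\rho_Q:Q\in\mathscr Q\}$. The symbol map of a map $\Phi$ that sends $\mathfrak S_{GIG}$ into itself is the map $\gamma_\Phi:\mathscr Q\to\mathscr Q$ defined by $\langle\phi,\gamma_\Phi(Q)\psi\rangle=\tau(\Phi(\rho_Q)Z^*(\psi)Z(\phi))$ for all $\phi,\psi\in\mathcal H_1$; equivalently $\Phi(\rho_Q)=\rho_{\gamma_\Phi(Q)}$.
   Formalization: The dimension N of the one-particle space is assumed to be at least 2; for N = 0 the symbol set is a single point and for N = 1 the Gaussian state depends affinely on Q, so every symbol map is affine and the claim fails there. *)

theory Defs
  imports "HOL-Analysis.Analysis" "HOL-Library.Nonpos_Ints"
begin

section \<open>Complex Hilbert spaces\<close>

text \<open>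
  The real Banach space structure is the one of the library; the class adds the complex scalar
  multiplication and an inner product that is conjugate linear in the \<^emph>\<open>first\<close> variable.
  Additivity in the first variable and definiteness follow from the axioms.
\<close>

class complex_hilbert_space = banach +
  fixes scaleC :: "complex \<Rightarrow> 'a \<Rightarrow> 'a" (infixr "*\<^sub>C" 75)
    and cinner :: "'a \<Rightarrow> 'a \<Rightarrow> complex"
  assumes scaleC_of_real: "of_real r *\<^sub>C x = r *\<^sub>R x"
    and scaleC_add_right: "a *\<^sub>C (x + y) = a *\<^sub>C x + a *\<^sub>C y"
    and scaleC_add_left: "(a + b) *\<^sub>C x = a *\<^sub>C x + b *\<^sub>C x"
    and scaleC_scaleC: "a *\<^sub>C b *\<^sub>C x = (a * b) *\<^sub>C x"
    and cinner_commute: "cinner x y = cnj (cinner y x)"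
    and cinner_add_right: "cinner x (y + z) = cinner x y + cinner x z"
    and cinner_scaleC_right: "cinner x (a *\<^sub>C y) = a * cinner x y"
    and cinner_norm: "cinner x x = of_real ((norm x)\<^sup>2)"

global_interpretation complex_vector:
  vector_space "scaleC :: complex \<Rightarrow> 'a \<Rightarrow> 'a::complex_hilbert_space"
proof unfold_locales
  fix x :: 'a
  show "1 *\<^sub>C x = x"
    using scaleC_of_real[of 1 x] by simp
qed (simp_all add: scaleC_add_right scaleC_add_left scaleC_scaleC)

definition finite_cdim :: "'a::complex_hilbert_space itself \<Rightarrow> bool" where
  "finite_cdim _ \<longleftrightarrow> (\<exists>B :: 'a set. finite B \<and> complex_vector.span B = UNIV)"

definition cdim :: "'a::complex_hilbert_space itself \<Rightarrow> nat" where
  "cdim _ = complex_vector.dim (UNIV :: 'a set)"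

text \<open>Only for finite dimensional spaces; the basis vectors are the values at \<open>i < cdim TYPE('a)\<close>.\<close>

definition orthonormal_basis :: "(nat \<Rightarrow> 'a::complex_hilbert_space) \<Rightarrow> bool" where
  "orthonormal_basis e \<longleftrightarrow>
     (\<forall>i < cdim TYPE('a). \<forall>j < cdim TYPE('a). cinner (e i) (e j) = (if i = j then 1 else 0)) \<and>
     complex_vector.span (e ` {..<cdim TYPE('a)}) = UNIV"

section \<open>Operators\<close>

definition bounded_clinear :: "('a::complex_hilbert_space \<Rightarrow> 'a) \<Rightarrow> bool" where
  "bounded_clinear A \<longleftrightarrow> bounded_linear A \<and> (\<forall>c x. A (c *\<^sub>C x) = c *\<^sub>C A x)"

definition adj :: "('a::complex_hilbert_space \<Rightarrow> 'a) \<Rightarrow> 'a \<Rightarrow> 'a" where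
  "adj A = (THE B. bounded_clinear B \<and> (\<forall>x y. cinner (B x) y = cinner x (A y)))"

definition positive_op :: "('a::complex_hilbert_space \<Rightarrow> 'a) \<Rightarrow> bool" where
  "positive_op A \<longleftrightarrow> bounded_clinear A \<and> (\<forall>x. cinner x (A x) \<in> \<real>\<^sub>\<ge>\<^sub>0)"

text \<open>The trace of an operator on a finite dimensional space; it does not depend on the basis.\<close>

definition trace_op :: "('a::complex_hilbert_space \<Rightarrow> 'a) \<Rightarrow> complex" where
  "trace_op A = (let e = (SOME e. orthonormal_basis e) in
     \<Sum>i < cdim TYPE('a). cinner (e i) (A (e i)))"

inductive_set star_algebra ::
    "('a::complex_hilbert_space \<Rightarrow> 'a) set \<Rightarrow> ('a \<Rightarrow> 'a) set"
  for S :: "('a \<Rightarrow> 'a) set" where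
  gen: "A \<in> S \<Longrightarrow> A \<in> star_algebra S"
| scale: "A \<in> star_algebra S \<Longrightarrow> (\<lambda>x. c *\<^sub>C A x) \<in> star_algebra S"
| add: "A \<in> star_algebra S \<Longrightarrow> B \<in> star_algebra S \<Longrightarrow> (\<lambda>x. A x + B x) \<in> star_algebra S"
| mult: "A \<in> star_algebra S \<Longrightarrow> B \<in> star_algebra S \<Longrightarrow> A \<circ> B \<in> star_algebra S"
| star: "A \<in> star_algebra S \<Longrightarrow> adj A \<in> star_algebra S"

section \<open>CAR fields\<close>

definition CAR_field ::
    "('h::complex_hilbert_space \<Rightarrow> 'k::complex_hilbert_space \<Rightarrow> 'k) \<Rightarrow> bool" where
  "CAR_field Z \<longleftrightarrow>
     (\<forall>\<psi>. bounded_clinear (Z \<psi>)) \<and>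
     (\<forall>\<psi> \<phi> x. Z (\<psi> + \<phi>) x = Z \<psi> x + Z \<phi> x) \<and>
     (\<forall>c \<psi> x. Z (c *\<^sub>C \<psi>) x = cnj c *\<^sub>C Z \<psi> x) \<and>
     (\<forall>\<psi> \<phi> x. Z \<psi> (adj (Z \<phi>) x) + adj (Z \<phi>) (Z \<psi> x) = cinner \<psi> \<phi> *\<^sub>C x) \<and>
     (\<forall>\<psi> \<phi> x. Z \<psi> (Z \<phi> x) + Z \<phi> (Z \<psi> x) = 0)"

text \<open>
  Topological irreducibility. No finiteness is assumed of the space acted on: that its dimension is
  \<open>2 ^ cdim TYPE('h)\<close> is a consequence when \<open>'h\<close> is finite dimensional.
\<close>

definition acts_irreducibly ::
    "('h::complex_hilbert_space \<Rightarrow> 'k::complex_hilbert_space \<Rightarrow> 'k) \<Rightarrow> bool" where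
  "acts_irreducibly Z \<longleftrightarrow>
     (UNIV :: 'k set) \<noteq> {0} \<and>
     (\<forall>S. closed S \<and> complex_vector.subspace S \<and>
          (\<forall>\<psi>. \<forall>x\<in>S. Z \<psi> x \<in> S \<and> adj (Z \<psi>) x \<in> S) \<longrightarrow> S = {0} \<or> S = UNIV)"

definition CAR_algebra ::
    "('h::complex_hilbert_space \<Rightarrow> 'k::complex_hilbert_space \<Rightarrow> 'k) \<Rightarrow> ('k \<Rightarrow> 'k) set" where
  "CAR_algebra Z = star_algebra (range Z)"

text \<open>The argument \<open>Z\<close> only fixes the one-particle space, whose dimension enters the normalization.\<close>

definition ntrace ::
    "('h::complex_hilbert_space \<Rightarrow> 'k::complex_hilbert_space \<Rightarrow> 'k) \<Rightarrow> ('k \<Rightarrow> 'k) \<Rightarrow> complex" where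
  "ntrace Z A = trace_op A / 2 ^ cdim TYPE('h)"

section \<open>Quantum operations\<close>

text \<open>
  \<open>block_positive n M\<close>: the operator with blocks \<open>M i j\<close> is positive on the \<open>n\<close>-fold direct sum.
\<close>

definition block_positive ::
    "nat \<Rightarrow> (nat \<Rightarrow> nat \<Rightarrow> 'k::complex_hilbert_space \<Rightarrow> 'k) \<Rightarrow> bool" where
  "block_positive n M \<longleftrightarrow>
     (\<forall>x :: nat \<Rightarrow> 'k. (\<Sum>i<n. \<Sum>j<n. cinner (x i) (M i j (x j))) \<in> \<real>\<^sub>\<ge>\<^sub>0)"

definition completely_positive_on ::
    "('k::complex_hilbert_space \<Rightarrow> 'k) set \<Rightarrow> (('k \<Rightarrow> 'k) \<Rightarrow> 'k \<Rightarrow> 'k) \<Rightarrow> bool" where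
  "completely_positive_on \<A> \<Phi> \<longleftrightarrow>
     (\<forall>n M. (\<forall>i<n. \<forall>j<n. M i j \<in> \<A>) \<longrightarrow> block_positive n M \<longrightarrow>
            block_positive n (\<lambda>i j. \<Phi> (M i j)))"

text \<open>Maps on the CAR algebra are total functions whose values outside the algebra are irrelevant.\<close>

definition quantum_operation ::
    "('h::complex_hilbert_space \<Rightarrow> 'k::complex_hilbert_space \<Rightarrow> 'k) \<Rightarrow>
     (('k \<Rightarrow> 'k) \<Rightarrow> 'k \<Rightarrow> 'k) \<Rightarrow> bool" where
  "quantum_operation Z \<Phi> \<longleftrightarrow>
     \<Phi> ` CAR_algebra Z \<subseteq> CAR_algebra Z \<and>
     (\<forall>A \<in> CAR_algebra Z. \<forall>B \<in> CAR_algebra Z. \<Phi> (\<lambda>x. A x + B x) = (\<lambda>x. \<Phi> A x + \<Phi> B x)) \<and>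
     (\<forall>c. \<forall>A \<in> CAR_algebra Z. \<Phi> (\<lambda>x. c *\<^sub>C A x) = (\<lambda>x. c *\<^sub>C \<Phi> A x)) \<and>
     completely_positive_on (CAR_algebra Z) \<Phi> \<and>
     (\<forall>A \<in> CAR_algebra Z. ntrace Z (\<Phi> A) = ntrace Z A)"

section \<open>Gauge invariant Gaussian states\<close>

definition symbols :: "('h::complex_hilbert_space \<Rightarrow> 'h) set" where
  "symbols = {Q. positive_op Q \<and> positive_op (\<lambda>x. x - Q x)}"

definition spectral_decomposition ::
    "('h::complex_hilbert_space \<Rightarrow> 'h) \<Rightarrow> (nat \<Rightarrow> real) \<Rightarrow> (nat \<Rightarrow> 'h) \<Rightarrow> bool" where
  "spectral_decomposition Q \<mu> \<psi> \<longleftrightarrow>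
     orthonormal_basis \<psi> \<and>
     (\<forall>\<phi>. Q \<phi> = (\<Sum>j < cdim TYPE('h). of_real (\<mu> j) *\<^sub>C cinner (\<psi> j) \<phi> *\<^sub>C \<psi> j))"

definition gaussian_factor ::
    "('h::complex_hilbert_space \<Rightarrow> 'k::complex_hilbert_space \<Rightarrow> 'k) \<Rightarrow> real \<Rightarrow> 'h \<Rightarrow> 'k \<Rightarrow> 'k" where
  "gaussian_factor Z m \<psi> = (\<lambda>x. of_real ((1 - m) * 2) *\<^sub>C Z \<psi> (adj (Z \<psi>) x)
                              + of_real (m * 2) *\<^sub>C adj (Z \<psi>) (Z \<psi> x))"

text \<open>
  The factors commute, and the product does not depend on the spectral decomposition that is chosen.
\<close>

definition gaussian_state ::
    "('h::complex_hilbert_space \<Rightarrow> 'k::complex_hilbert_space \<Rightarrow> 'k) \<Rightarrow> ('h \<Rightarrow> 'h) \<Rightarrow> 'k \<Rightarrow> 'k" where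
  "gaussian_state Z Q = (SOME \<rho>. \<exists>\<mu> \<psi>. spectral_decomposition Q \<mu> \<psi> \<and>
     \<rho> = foldr (\<lambda>j R. gaussian_factor Z (\<mu> j) (\<psi> j) \<circ> R) [0..<cdim TYPE('h)] id)"

definition GIG_states ::
    "('h::complex_hilbert_space \<Rightarrow> 'k::complex_hilbert_space \<Rightarrow> 'k) \<Rightarrow> ('k \<Rightarrow> 'k) set" where
  "GIG_states Z = gaussian_state Z ` symbols"

definition symbol_map ::
    "('h::complex_hilbert_space \<Rightarrow> 'k::complex_hilbert_space \<Rightarrow> 'k) \<Rightarrow>
     (('k \<Rightarrow> 'k) \<Rightarrow> 'k \<Rightarrow> 'k) \<Rightarrow> ('h \<Rightarrow> 'h) \<Rightarrow> 'h \<Rightarrow> 'h" where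
  "symbol_map Z \<Phi> Q = (THE G. bounded_clinear G \<and>
     (\<forall>\<phi> \<psi>. cinner \<phi> (G \<psi>) = ntrace Z (\<Phi> (gaussian_state Z Q) \<circ> adj (Z \<psi>) \<circ> Z \<phi>)))"

definition affine_on_symbols ::
    "(('h::complex_hilbert_space \<Rightarrow> 'h) \<Rightarrow> 'h \<Rightarrow> 'h) \<Rightarrow> bool" where
  "affine_on_symbols \<gamma> \<longleftrightarrow>
     (\<forall>Q \<in> symbols. \<forall>R \<in> symbols. \<forall>t \<in> {0..1}.
        \<gamma> (\<lambda>x. t *\<^sub>R Q x + (1 - t) *\<^sub>R R x) = (\<lambda>x. t *\<^sub>R \<gamma> Q x + (1 - t) *\<^sub>R \<gamma> R x))"

end

theory Submission
  imports Defs "HOL-Computational_Algebra.Fundamental_Theorem_Algebra"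
begin

text \<open>
  The operation measures whether the system is in the vacuum \<open>\<Omega>\<close> and then prepares a Gaussian state:
  for a unit vector \<open>u\<close> and \<open>n = Z\<^sup>*(u) Z(u)\<close> it is
  \<open>A \<mapsto> 2\<^sup>-\<^sup>N (\<langle>\<Omega>, A \<Omega>\<rangle> 2n + (Tr A - \<langle>\<Omega>, A \<Omega>\<rangle>) 2(1 - n))\<close>. Both prepared states are Gaussian and
  they differ in the single mode \<open>u\<close> only, so their mixtures are again Gaussian. On \<open>\<rho>\<^sub>Q\<close> the first
  outcome has probability \<open>p = det (1 - Q)\<close>, and the symbol map
  \<open>Q \<mapsto> 1/2 + (p - 1/2) |u\<rangle>\<langle>u|\<close> is not affine because \<open>det (1 - Q)\<close> is not affine for \<open>N \<ge> 2\<close>.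
\<close>

section \<open>Inner products\<close>

text \<open>The map from \<open>Q\<close> to its state is a product of \<open>N\<close> factors,
  hence not affine once \<open>N \<ge> 2\<close>, and a linear operation can read this off: the
  vacuum expectation picks up \<open>1 - \<mu> j\<close> from every factor. The obstacle is the
  output, since mixtures of Gaussian states are in general not Gaussian. The operation therefore
  answers inside a segment made of Gaussian states only. One mode supplies it, because a single
  factor is affine in its occupation; all other modes stay at occupation 1/2, where the factor is
  the identity. For \<open>N = 1\<close> the state itself is affine in the symbol, so every linear
  map preserving these states has an affine symbol map. This explains the bound on the dimension.
  Two features of the definitions shape the rest. \<open>gaussian_state\<close> chooses an unknown
  spectral decomposition, so computations have to be valid for all of them. The space acted on is
  not assumed finite dimensional, so its dimension \<open>2 ^ N\<close> has to be derived from
  irreducibility before traces can be evaluated.\<close>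

lemma cinner_add_left: "cinner (x + y) z = cinner x z + cinner y z"
  by (metis cinner_add_right cinner_commute complex_cnj_add)

lemma cinner_scaleC_left: "cinner (a *\<^sub>C x) y = cnj a * cinner x y"
  by (metis cinner_commute cinner_scaleC_right complex_cnj_mult)

lemma cinner_zero_right [simp]: "cinner x 0 = 0"
  using cinner_add_right[of x 0 0] by simp

lemma cinner_zero_left [simp]: "cinner 0 x = 0"
  using cinner_add_left[of 0 0 x] by simp

lemma cinner_minus_right: "cinner x (- y) = - cinner x y"
  using cinner_add_right[of x y "- y"] by (simp add: add_eq_0_iff)

lemma cinner_minus_left: "cinner (- x) y = - cinner x y"
  using cinner_add_left[of x "- x" y] by (simp add: add_eq_0_iff)

lemma cinner_diff_right: "cinner x (y - z) = cinner x y - cinner x z"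
  using cinner_add_right[of x y "- z"] by (simp add: cinner_minus_right)

lemma cinner_diff_left: "cinner (x - y) z = cinner x z - cinner y z"
  using cinner_add_left[of x "- y" z] by (simp add: cinner_minus_left)

lemma cinner_sum_right: "cinner x (\<Sum>i\<in>I. f i) = (\<Sum>i\<in>I. cinner x (f i))"
  by (induction I rule: infinite_finite_induct) (simp_all add: cinner_add_right)

lemma scaleC_minus1_left: "(-1) *\<^sub>C x = - (x::'a::complex_hilbert_space)"
  using complex_vector.scale_minus_left[of 1 x] by simp

lemma scaleR_scaleC: "r *\<^sub>R x = of_real r *\<^sub>C (x::'a::complex_hilbert_space)"
  by (simp add: scaleC_of_real)

lemma cinner_self_eq_zero [simp]: "cinner x x = 0 \<longleftrightarrow> x = 0"
  by (simp add: cinner_norm)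

lemma cinner_extensionality:
  assumes "\<And>y. cinner y x = cinner y z"
  shows "x = z"
proof -
  have "cinner (x - z) (x - z) = 0"
    using assms by (simp add: cinner_diff_right)
  then show ?thesis by simp
qed

lemma cinner_extensionality_left:
  assumes "\<And>y. cinner x y = cinner z y"
  shows "x = z"
proof (rule cinner_extensionality)
  fix y show "cinner y x = cinner y z"
    using assms[of y] cinner_commute[of y x] cinner_commute[of y z] by simp
qed

lemma norm_scaleC: "norm (a *\<^sub>C x) = cmod a * norm (x::'a::complex_hilbert_space)"
proof -
  have "complex_of_real ((norm (a *\<^sub>C x))\<^sup>2) = (a * cnj a) * of_real ((norm x)\<^sup>2)"
    using cinner_norm[of "a *\<^sub>C x"] cinner_norm[of x]
    by (simp add: cinner_scaleC_left cinner_scaleC_right algebra_simps)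
  also have "\<dots> = of_real ((cmod a * norm x)\<^sup>2)"
    by (simp add: complex_mult_cnj cmod_power2 power_mult_distrib)
  finally have "(norm (a *\<^sub>C x))\<^sup>2 = (cmod a * norm x)\<^sup>2"
    using of_real_eq_iff by blast
  then show ?thesis by (simp add: power2_eq_iff_nonneg)
qed

lemma mult_cinner_commute: "cinner x y * cinner y x = of_real ((cmod (cinner x y))\<^sup>2)"
  using cinner_commute[of y x] by (metis complex_norm_square)

text \<open>Pythagoras for the part of \<open>x\<close> orthogonal to \<open>y\<close>.
  Nonnegativity of the left side is Cauchy-Schwarz, and in the Riesz proof the drop in norm
  contradicts minimality unless the vectors are orthogonal.\<close>

lemma norm_square_minus_projection:
  fixes x y :: "'a::complex_hilbert_space"
  assumes "y \<noteq> 0"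
  shows "(norm (x - (cinner y x / cinner y y) *\<^sub>C y))\<^sup>2
           = (norm x)\<^sup>2 - (cmod (cinner y x))\<^sup>2 / (norm y)\<^sup>2"
proof -
  let ?c = "cinner y x / cinner y y"
  have c: "cinner y (x - ?c *\<^sub>C y) = 0"
    using assms by (simp add: cinner_diff_right cinner_scaleC_right)
  have "complex_of_real ((norm (x - ?c *\<^sub>C y))\<^sup>2) = cinner x (x - ?c *\<^sub>C y)"
    unfolding cinner_norm[symmetric] cinner_diff_left[of x] cinner_scaleC_left c by simp
  also have "\<dots> = of_real ((norm x)\<^sup>2) - (cinner y x * cinner x y) / of_real ((norm y)\<^sup>2)"
    by (simp add: cinner_diff_right cinner_scaleC_right cinner_norm)
  also have "\<dots> = of_real ((norm x)\<^sup>2 - (cmod (cinner y x))\<^sup>2 / (norm y)\<^sup>2)"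
    unfolding mult_cinner_commute by simp
  finally show ?thesis using of_real_eq_iff by blast
qed

lemma norm_cinner_le: "cmod (cinner x y) \<le> norm x * norm y"
proof (cases "x = 0")
  case False
  have "0 \<le> (norm y)\<^sup>2 - (cmod (cinner x y))\<^sup>2 / (norm x)\<^sup>2"
    using norm_square_minus_projection[OF False, of y] by (metis zero_le_power2)
  then have "(cmod (cinner x y))\<^sup>2 \<le> (norm x * norm y)\<^sup>2"
    using False by (simp add: field_simps power_mult_distrib)
  then show ?thesis by (rule power2_le_imp_le) simp
qed simp

lemma bounded_linear_cinner_right: "bounded_linear (cinner x)"
  by (rule bounded_linear_intro[where K = "norm x"])
    (simp_all add: cinner_add_right scaleR_scaleC cinner_scaleC_right scaleR_conv_of_real
      norm_cinner_le mult.commute[of _ "norm x"])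

lemma bounded_linear_scaleC_right:
  "bounded_linear (\<lambda>x. a *\<^sub>C x :: 'a::complex_hilbert_space)"
  by (rule bounded_linear_intro[where K = "cmod a"])
    (simp_all add: scaleC_add_right scaleR_scaleC scaleC_scaleC norm_scaleC mult.commute)

lemma bounded_linear_scaleC_left:
  "bounded_linear (\<lambda>a. a *\<^sub>C x :: 'a::complex_hilbert_space)"
  by (rule bounded_linear_intro[where K = "norm x"])
    (simp_all add: scaleC_add_left scaleR_scaleC scaleC_scaleC norm_scaleC scaleR_conv_of_real)

text \<open>Converts near-minimal norm into closeness, which makes a minimising sequence in an
  affine hyperplane Cauchy.\<close>

lemma parallelogram_law:
  "(norm (x + y))\<^sup>2 + (norm (x - y))\<^sup>2 = 2 * (norm x)\<^sup>2 + 2 * (norm (y::'a::complex_hilbert_space))\<^sup>2"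
proof -
  have "complex_of_real ((norm (x + y))\<^sup>2 + (norm (x - y))\<^sup>2) = of_real (2 * (norm x)\<^sup>2 + 2 * (norm y)\<^sup>2)"
    unfolding of_real_add of_real_mult cinner_norm[symmetric]
    by (simp add: cinner_add_left cinner_add_right cinner_diff_left cinner_diff_right)
  then show ?thesis using of_real_eq_iff by blast
qed

section \<open>Riesz representation and adjoints\<close>

text \<open>The representing vector is proportional to the vector of least norm in the hyperplane
  \<open>f x = 1\<close>.\<close>

theorem riesz_representation:
  fixes f :: "'a::complex_hilbert_space \<Rightarrow> complex"
  assumes bl: "bounded_linear f" and hom: "\<And>c x. f (c *\<^sub>C x) = c * f x"
  shows "\<exists>v. \<forall>x. f x = cinner v x"
proof (cases "\<forall>x. f x = 0")
  case True
  then show ?thesis by (intro exI[of _ 0]) simp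
next
  case False
  interpret f: bounded_linear f by (rule bl)
  define M where "M = {x. f x = 1}"
  define D where "D = Inf ((\<lambda>x. (norm x)\<^sup>2) ` M)"
  obtain x0 where "f x0 \<noteq> 0" using False by blast
  then have "(1 / f x0) *\<^sub>C x0 \<in> M" by (simp add: M_def hom)
  then have ne: "(\<lambda>x. (norm x)\<^sup>2) ` M \<noteq> {}" by blast
  have bdd: "bdd_below ((\<lambda>x. (norm x)\<^sup>2) ` M)"
    by (rule bdd_belowI[of _ 0]) auto
  have D_le: "D \<le> (norm x)\<^sup>2" if "x \<in> M" for x
    unfolding D_def using that bdd by (intro cInf_lower) auto
  have "\<exists>x\<in>M. (norm x)\<^sup>2 < D + inverse (real (Suc n))" for n
    using cInf_less_iff[OF ne bdd, of "D + inverse (real (Suc n))"]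
    by (auto simp: D_def)
  then obtain X where X: "\<And>n. X n \<in> M" "\<And>n. (norm (X n))\<^sup>2 < D + inverse (real (Suc n))"
    by metis
  have close: "(norm (X m - X n))\<^sup>2 \<le> 2 * inverse (real (Suc m)) + 2 * inverse (real (Suc n))"
    for m n
  proof -
    \<comment> \<open>The midpoint stays in the hyperplane, so the sum has squared norm at least
      \<open>4 * D\<close>, and the parallelogram law bounds the difference.\<close>
    have "(1/2) *\<^sub>R (X m + X n) \<in> M"
      using X(1)[of m] X(1)[of n] by (simp add: M_def f.scaleR f.add scaleR_conv_of_real)
    from D_le[OF this] have "4 * D \<le> (norm (X m + X n))\<^sup>2"
      by (simp add: power_divide)
    then show ?thesis
      using parallelogram_law[of "X m" "X n"] X(2)[of m] X(2)[of n] by linarith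
  qed
  have "Cauchy X"
  proof (rule metric_CauchyI)
    fix e :: real assume e: "e > 0"
    then obtain N where N: "inverse (real (Suc N)) < e\<^sup>2 / 4"
      using reals_Archimedean[of "e\<^sup>2 / 4"] by auto
    show "\<exists>M. \<forall>m\<ge>M. \<forall>n\<ge>M. dist (X m) (X n) < e"
    proof (intro exI[of _ N] allI impI)
      fix m n assume "m \<ge> N" "n \<ge> N"
      then have "inverse (real (Suc m)) \<le> inverse (real (Suc N))"
        "inverse (real (Suc n)) \<le> inverse (real (Suc N))"
        by (auto intro!: le_imp_inverse_le)
      then have "(norm (X m - X n))\<^sup>2 < e\<^sup>2"
        using close[of m n] N by linarith
      then show "dist (X m) (X n) < e"
        using e by (simp add: dist_norm power2_less_imp_less)
    qed
  qed
  then obtain v where v: "X \<longlonglongrightarrow> v"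
    using convergent_eq_Cauchy by blast
  have "(\<lambda>n. f (X n)) \<longlonglongrightarrow> f v" by (rule f.tendsto[OF v])
  then have fv: "f v = 1"
    using X(1) by (simp add: M_def LIMSEQ_const_iff)
  have "(\<lambda>n. D + inverse (real (Suc n))) \<longlonglongrightarrow> D + 0"
    by (intro tendsto_add tendsto_const LIMSEQ_inverse_real_of_nat)
  moreover have "(\<lambda>n. (norm (X n))\<^sup>2) \<longlonglongrightarrow> (norm v)\<^sup>2"
    by (intro tendsto_power tendsto_norm v)
  ultimately have "(norm v)\<^sup>2 \<le> D + 0"
    by (rule tendsto_le[OF sequentially_bot]) (simp add: less_imp_le X(2) del: of_nat_Suc)
  then have min: "(norm v)\<^sup>2 \<le> (norm x)\<^sup>2" if "f x = 1" for x
    using D_le[of x] that order_trans by (fastforce simp: M_def)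
  have orth: "cinner v y = 0" if y: "f y = 0" for y
  proof (cases "y = 0")
    case False
    \<comment> \<open>Subtracting a kernel vector stays in the hyperplane, and this multiple of
      \<open>y\<close> would shorten \<open>v\<close> unless the two are orthogonal.\<close>
    have "f (v - (cinner y v / cinner y y) *\<^sub>C y) = 1"
      by (simp add: f.diff hom y fv)
    from min[OF this] have "(cmod (cinner y v))\<^sup>2 / (norm y)\<^sup>2 \<le> 0"
      unfolding norm_square_minus_projection[OF False] by simp
    then have "cinner y v = 0" using False by (simp add: divide_le_0_iff)
    then show ?thesis using cinner_commute[of v y] by simp
  qed simp
  have "v \<noteq> 0" using fv f.zero by auto
  have "f x = cinner ((1 / cinner v v) *\<^sub>C v) x" for x
  proof -
    have "f (x - f x *\<^sub>C v) = 0" by (simp add: f.diff hom fv)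
    then have "cinner v x = f x * cinner v v"
      using orth[of "x - f x *\<^sub>C v"] by (simp add: cinner_diff_right cinner_scaleC_right)
    then show ?thesis
      using \<open>v \<noteq> 0\<close> cinner_commute[of v v] by (simp add: cinner_scaleC_left)
  qed
  then show ?thesis by blast
qed

section \<open>Bounded complex linear operators and their adjoints\<close>

lemma bounded_clinear_add: "bounded_clinear A \<Longrightarrow> A (x + y) = A x + A y"
  by (simp add: bounded_clinear_def bounded_linear.linear linear_add)

lemma bounded_clinear_diff: "bounded_clinear A \<Longrightarrow> A (x - y) = A x - A y"
  by (simp add: bounded_clinear_def bounded_linear.linear linear_diff)

lemma bounded_clinear_minus: "bounded_clinear A \<Longrightarrow> A (- x) = - A x"
  by (simp add: bounded_clinear_def bounded_linear.linear linear_neg)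

lemma bounded_clinear_zero: "bounded_clinear A \<Longrightarrow> A 0 = 0"
  by (simp add: bounded_clinear_def bounded_linear.linear linear_0)

lemma bounded_clinear_sum: "bounded_clinear A \<Longrightarrow> A (\<Sum>i\<in>I. f i) = (\<Sum>i\<in>I. A (f i))"
  by (simp add: bounded_clinear_def bounded_linear.linear linear_sum)

lemma bounded_clinear_scaleC: "bounded_clinear A \<Longrightarrow> A (c *\<^sub>C x) = c *\<^sub>C A x"
  by (simp add: bounded_clinear_def)

lemmas bounded_clinear_simps =
  bounded_clinear_add bounded_clinear_diff bounded_clinear_minus bounded_clinear_zero
  bounded_clinear_scaleC

lemma bounded_clinear_compose: "bounded_clinear A \<Longrightarrow> bounded_clinear B \<Longrightarrow> bounded_clinear (A \<circ> B)"
  unfolding bounded_clinear_def comp_def by (auto intro: bounded_linear_compose)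

lemma bounded_clinear_plus:
  "bounded_clinear A \<Longrightarrow> bounded_clinear B \<Longrightarrow> bounded_clinear (\<lambda>x. A x + B x)"
  unfolding bounded_clinear_def by (auto intro: bounded_linear_add simp: scaleC_add_right)

lemma bounded_clinear_scale: "bounded_clinear A \<Longrightarrow> bounded_clinear (\<lambda>x. c *\<^sub>C A x)"
  unfolding bounded_clinear_def
  using bounded_linear_compose[OF bounded_linear_scaleC_right[of c], of A]
  by (auto simp: scaleC_scaleC mult.commute)

lemma bounded_clinear_id: "bounded_clinear (\<lambda>x. x)"
  by (simp add: bounded_clinear_def)

lemma bounded_clinear_rank_one: "bounded_clinear (\<lambda>x. cinner v x *\<^sub>C w)"
  unfolding bounded_clinear_def
  using bounded_linear_compose[OF bounded_linear_scaleC_left bounded_linear_cinner_right]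
  by (auto simp: cinner_scaleC_right scaleC_scaleC)

lemma adj_eqI:
  assumes "bounded_clinear B" and "\<And>x y. cinner (B x) y = cinner x (A y)"
  shows "adj A = B"
  unfolding adj_def
proof (rule the_equality)
  fix C assume C: "bounded_clinear C \<and> (\<forall>x y. cinner (C x) y = cinner x (A y))"
  show "C = B"
    by (rule ext, rule cinner_extensionality_left) (use C assms(2) in metis)
qed (use assms in blast)

text \<open>Riesz applied to the functional \<open>cinner x (A y)\<close> of \<open>y\<close> gives
  the candidate. Completeness of the space thus makes the definite description in \<open>adj\<close>
  denote, in any dimension.\<close>

lemma
  assumes A: "bounded_clinear A"
  shows bounded_clinear_adj: "bounded_clinear (adj A)"
    and cinner_adj_left: "cinner (adj A x) y = cinner x (A y)"
proof -
  obtain K where K: "\<And>x. norm (A x) \<le> norm x * K" "K > 0"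
    using A bounded_linear.pos_bounded unfolding bounded_clinear_def by blast
  have "\<exists>v. \<forall>y. cinner x (A y) = cinner v y" for x
  proof (rule riesz_representation)
    show "bounded_linear (\<lambda>y. cinner x (A y))"
      using A bounded_linear_compose[OF bounded_linear_cinner_right]
      unfolding bounded_clinear_def by blast
  qed (simp add: bounded_clinear_scaleC[OF A] cinner_scaleC_right)
  then obtain B where B: "\<And>x y. cinner x (A y) = cinner (B x) y"
    by metis
  have B_scale: "B (c *\<^sub>C x) = c *\<^sub>C B x" for c x
    by (rule cinner_extensionality_left) (simp add: B[symmetric] cinner_scaleC_left)
  have "bounded_linear B"
  proof (rule bounded_linear_intro[where K = K])
    fix x y and r :: real
    show "B (x + y) = B x + B y"
      by (rule cinner_extensionality_left) (simp add: B[symmetric] cinner_add_left)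
    show "B (r *\<^sub>R x) = r *\<^sub>R B x"
      by (simp add: scaleR_scaleC B_scale)
    \<comment> \<open>Moving one \<open>B\<close> across leaves \<open>A (B x)\<close>; after
      cancelling \<open>norm (B x)\<close> the bound of \<open>A\<close> is a bound of
      \<open>B\<close>.\<close>
    have "(norm (B x))\<^sup>2 = cmod (cinner (B x) (B x))"
      unfolding cinner_norm by (simp only: norm_of_real) simp
    also have "\<dots> \<le> norm x * norm (A (B x))"
      unfolding B[symmetric] by (rule norm_cinner_le)
    also have "\<dots> \<le> norm x * (norm (B x) * K)"
      by (intro mult_left_mono K) simp
    finally have "norm (B x) * norm (B x) \<le> norm (B x) * (norm x * K)"
      by (simp add: power2_eq_square mult_ac)
    then show "norm (B x) \<le> norm x * K"
      using K(2) by (cases "B x = 0") (auto simp: mult_le_cancel_left)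
  qed
  then have bcl: "bounded_clinear B" by (simp add: bounded_clinear_def B_scale)
  then have "adj A = B" by (rule adj_eqI) (simp add: B)
  then show "bounded_clinear (adj A)" "cinner (adj A x) y = cinner x (A y)"
    using bcl B by auto
qed

lemma cinner_adj_right: "bounded_clinear A \<Longrightarrow> cinner x (adj A y) = cinner (A x) y"
  using cinner_adj_left cinner_commute by metis

lemma star_algebra_bounded_clinear:
  assumes "A \<in> star_algebra S" and "\<And>B. B \<in> S \<Longrightarrow> bounded_clinear B"
  shows "bounded_clinear A"
  using assms(1)
  by induction
    (blast intro: assms(2) bounded_clinear_scale bounded_clinear_plus bounded_clinear_compose
      bounded_clinear_adj)+

section \<open>The spectral theorem\<close>

text \<open>Sets rather than indexed families: the eigenbasis arises as a set of maximal cardinality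
  and is enumerated only in \<open>spectral_theorem\<close>.\<close>

definition orthonormal :: "'a::complex_hilbert_space set \<Rightarrow> bool" where
  "orthonormal E \<longleftrightarrow> (\<forall>x\<in>E. \<forall>y\<in>E. cinner x y = (if x = y then 1 else 0))"

lemma orthonormal_independent:
  assumes "orthonormal E" shows "complex_vector.independent E"
  unfolding complex_vector.dependent_explicit
proof safe
  fix t u v assume t: "finite t" "t \<subseteq> E" "(\<Sum>v\<in>t. u v *\<^sub>C v) = 0" "v \<in> t" "u v \<noteq> 0"
  have "0 = cinner v (\<Sum>w\<in>t. u w *\<^sub>C w)" using t(3) by simp
  also have "\<dots> = (\<Sum>w\<in>t. if v = w then u w else 0)"
    unfolding cinner_sum_right cinner_scaleC_right
    using assms t(2,4) by (intro sum.cong) (auto simp: orthonormal_def subset_iff)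
  also have "\<dots> = u v" using t(1,4) by simp
  finally show False using t(5) by simp
qed

text \<open>The vector \<open>p(Q) v\<close>.\<close>

definition poly_orbit :: "('a \<Rightarrow> 'a) \<Rightarrow> 'a::complex_hilbert_space \<Rightarrow> complex poly \<Rightarrow> 'a" where
  "poly_orbit Q v p = fold_coeffs (\<lambda>a x. a *\<^sub>C v + Q x) p 0"

text \<open>No determinants: the orbit of \<open>v\<close> is linearly dependent, so a nonzero
  polynomial in \<open>Q\<close> annihilates \<open>v\<close>. Take one of least degree and split
  off a root \<open>z\<close>; the cofactor applied to \<open>v\<close> is nonzero by minimality and
  lies in the kernel of \<open>Q - z\<close>.\<close>

lemma eigenvector_exists:
  fixes Q :: "'a::complex_hilbert_space \<Rightarrow> 'a"
  assumes Q: "bounded_clinear Q" and S: "complex_vector.subspace S"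
    and B: "finite B" "S \<subseteq> complex_vector.span B"
    and inv: "\<And>x. x \<in> S \<Longrightarrow> Q x \<in> S" and v: "v \<in> S" "v \<noteq> 0"
  shows "\<exists>x\<in>S. x \<noteq> 0 \<and> (\<exists>c. Q x = c *\<^sub>C x)"
proof -
  let ?ev = "poly_orbit Q v"
  note Q_simps = bounded_clinear_simps[OF Q]
  have ev0: "?ev 0 = 0" by (simp add: poly_orbit_def)
  have ev_pCons: "?ev (pCons a p) = a *\<^sub>C v + Q (?ev p)" for a p
    unfolding poly_orbit_def
    by (cases "pCons a p = 0") (auto simp: Q_simps)
  have ev_add: "?ev (p + q) = ?ev p + ?ev q" for p q
    by (induction p q rule: poly_induct2)
      (simp_all add: ev0 ev_pCons Q_simps scaleC_add_left algebra_simps)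
  have ev_smult: "?ev (smult a p) = a *\<^sub>C ?ev p" for a p
    by (induction p) (simp_all add: ev0 ev_pCons Q_simps scaleC_add_right scaleC_scaleC)
  have ev_S: "?ev p \<in> S" for p
    by (induction p)
      (auto simp: ev0 ev_pCons inv v complex_vector.subspace_0[OF S]
        intro!: complex_vector.subspace_add[OF S] complex_vector.subspace_scale[OF S])
  define w where "w i = ?ev (monom 1 i)" for i
  \<comment> \<open>Otherwise all initial segments of the orbit are independent, and one of length
    \<open>Suc (card B)\<close> does not fit into the span of \<open>B\<close>.\<close>
  have "\<exists>k. w k \<in> complex_vector.span (w ` {..<k})"
  proof (rule ccontr)
    assume "\<not> ?thesis"
    then have notin: "w k \<notin> complex_vector.span (w ` {..<k})" for k by blast
    have "complex_vector.independent (w ` {..<n}) \<and> card (w ` {..<n}) = n" for n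
    proof (induction n)
      case (Suc n)
      have "w n \<notin> w ` {..<n}" using notin[of n] complex_vector.span_base[of "w n"] by metis
      then show ?case
        using Suc notin[of n] by (simp add: lessThan_Suc complex_vector.independent_insert)
    qed (simp add: complex_vector.independent_empty)
    moreover have "w ` {..<n} \<subseteq> complex_vector.span B" for n
      using B(2) ev_S by (auto simp: w_def)
    ultimately have "Suc (card B) \<le> card B"
      using complex_vector.independent_span_bound[OF B(1)] by metis
    then show False by simp
  qed
  then obtain k where k: "w k \<in> complex_vector.span (w ` {..<k})" by blast
  \<comment> \<open>Orbit values of polynomials of degree below \<open>k\<close>. Membership of
    \<open>w k\<close> gives an annihilating polynomial whose coefficient at \<open>k\<close> is 1,
    hence a nonzero one.\<close>
  let ?V = "?ev ` {p. \<forall>i\<ge>k. coeff p i = 0}"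
  have "complex_vector.span (w ` {..<k}) \<subseteq> ?V"
  proof (rule complex_vector.span_minimal)
    show "w ` {..<k} \<subseteq> ?V" by (auto simp: w_def)
    show "complex_vector.subspace ?V"
    proof (rule complex_vector.subspaceI)
      show "0 \<in> ?V" using ev0 by (intro image_eqI[of _ _ 0]) auto
    next
      fix x y assume "x \<in> ?V" "y \<in> ?V"
      then obtain p q where "x = ?ev p" "y = ?ev q" "\<forall>i\<ge>k. coeff p i = 0" "\<forall>i\<ge>k. coeff q i = 0"
        by blast
      then show "x + y \<in> ?V"
        by (intro image_eqI[of _ _ "p + q"]) (simp_all add: ev_add)
    next
      fix c x assume "x \<in> ?V"
      then obtain p where "x = ?ev p" "\<forall>i\<ge>k. coeff p i = 0"
        by blast
      then show "c *\<^sub>C x \<in> ?V"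
        by (intro image_eqI[of _ _ "smult c p"]) (simp_all add: ev_smult)
    qed
  qed
  then obtain p where p: "w k = ?ev p" "\<forall>i\<ge>k. coeff p i = 0" using k by blast
  have "?ev (monom 1 k + smult (-1) p) = 0"
    by (simp only: ev_add ev_smult) (use p(1) in \<open>simp add: w_def scaleC_minus1_left\<close>)
  moreover have "monom 1 k + smult (-1) p \<noteq> 0"
    using p(2) by (auto simp: poly_eq_iff intro!: exI[of _ k])
  ultimately have "\<exists>p. p \<noteq> 0 \<and> ?ev p = 0" by blast
  then obtain p where p: "p \<noteq> 0" "?ev p = 0"
    and minp: "\<And>q. q \<noteq> 0 \<Longrightarrow> ?ev q = 0 \<Longrightarrow> degree p \<le> degree q"
    using ex_has_least_nat[of "\<lambda>p. p \<noteq> 0 \<and> ?ev p = 0" _ degree] by blast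
  have "degree p \<noteq> 0"
  proof
    assume "degree p = 0"
    then obtain a where "p = [:a:]" by (rule degree_eq_zeroE)
    then show False using p v(2) by (auto simp: ev_pCons ev0 Q_simps)
  qed
  then have "\<not> constant (poly p)" by (simp add: constant_degree)
  then obtain z where "poly p z = 0" using fundamental_theorem_of_algebra by blast
  then obtain q where q: "p = [:- z, 1:] * q" by (auto simp: poly_eq_0_iff_dvd)
  then have "q \<noteq> 0" using p(1) by auto
  then have "degree p = Suc (degree q)" using q by (simp add: degree_mult_eq del: mult_pCons_left)
  then have nz: "?ev q \<noteq> 0" using minp[OF \<open>q \<noteq> 0\<close>] by auto
  \<comment> \<open>Splitting the linear factor this way lets \<open>ev_pCons\<close> turn
    multiplication by the variable into an application of \<open>Q\<close>.\<close>
  have "p = smult (- z) q + pCons 0 q" using q by simp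
  then have "0 = (- z) *\<^sub>C ?ev q + Q (?ev q)"
    using p(2) by (simp only: ev_add ev_smult ev_pCons) simp
  then have "Q (?ev q) = z *\<^sub>C ?ev q" by simp
  then show ?thesis using nz ev_S by blast
qed

text \<open>A maximal orthonormal set of eigenvectors in \<open>S\<close> has no orthogonal complement in \<open>S\<close>.\<close>

lemma orthonormal_eigenbasis:
  fixes Q :: "'a::complex_hilbert_space \<Rightarrow> 'a"
  assumes Q: "bounded_clinear Q" and sa: "\<And>x y. cinner (Q x) y = cinner x (Q y)"
    and S: "complex_vector.subspace S"
    and B: "finite B" "S \<subseteq> complex_vector.span B"
    and inv: "\<And>x. x \<in> S \<Longrightarrow> Q x \<in> S"
  shows "\<exists>E. finite E \<and> E \<subseteq> S \<and> orthonormal E \<and> (\<forall>x\<in>E. \<exists>c. Q x = c *\<^sub>C x) \<and>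
           (\<forall>x\<in>S. x = (\<Sum>e\<in>E. cinner e x *\<^sub>C e))"
proof -
  let ?P = "\<lambda>E. E \<subseteq> S \<and> orthonormal E \<and> (\<forall>x\<in>E. \<exists>c. Q x = c *\<^sub>C x)"
  have bound: "finite E \<and> card E \<le> card B" if "?P E" for E
    using complex_vector.independent_span_bound[OF B(1) orthonormal_independent, of E] that B(2)
    by blast
  have "?P {}" by (simp add: orthonormal_def)
  moreover have "\<forall>E. ?P E \<longrightarrow> card E < Suc (card B)" using bound by (auto simp: less_Suc_eq_le)
  ultimately obtain E where E: "?P E" and maxE: "\<And>F. ?P F \<Longrightarrow> card F \<le> card E"
    using ex_has_greatest_nat[of ?P "{}" card "Suc (card B)"] by blast
  have fin: "finite E" using bound E by blast
  let ?T = "{x \<in> S. \<forall>e\<in>E. cinner e x = 0}"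
  have T0: "x = 0" if x: "x \<in> ?T" for x
  proof (rule ccontr)
    assume "x \<noteq> 0"
    \<comment> \<open>An eigenvector inside the complement would, once normalised, enlarge the
      maximal set \<open>E\<close>.\<close>
    have "\<exists>x\<in>?T. x \<noteq> 0 \<and> (\<exists>c. Q x = c *\<^sub>C x)"
    proof (rule eigenvector_exists[OF Q _ B(1) _ _ x \<open>x \<noteq> 0\<close>])
      show "complex_vector.subspace ?T"
        using S unfolding complex_vector.subspace_def
        by (auto simp: cinner_add_right cinner_scaleC_right)
      show "?T \<subseteq> complex_vector.span B" using B(2) by blast
    next
      fix y assume y: "y \<in> ?T"
      \<comment> \<open>Self-adjointness keeps the complement invariant: \<open>Q\<close> moves over
        to the eigenvector \<open>e\<close> and only rescales it.\<close>
      have "cinner e (Q y) = 0" if "e \<in> E" for e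
      proof -
        have "\<exists>c. Q e = c *\<^sub>C e" using E that by simp
        then obtain c where "Q e = c *\<^sub>C e" ..
        then have "cinner e (Q y) = cnj c * cinner e y"
          using sa[of e y] by (simp add: cinner_scaleC_left)
        then show ?thesis using y that by simp
      qed
      then show "Q y \<in> ?T" using inv y by blast
    qed
    then obtain y c where y: "y \<in> ?T" "y \<noteq> 0" "Q y = c *\<^sub>C y" by blast
    let ?y = "of_real (1 / norm y) *\<^sub>C y"
    have yy: "cinner ?y ?y = 1"
      unfolding cinner_norm norm_scaleC using y(2) by (simp add: norm_divide)
    have ye: "cinner e ?y = 0" "cinner ?y e = 0" if "e \<in> E" for e
      using y(1) that cinner_commute[of y e] by (simp_all add: cinner_scaleC_right cinner_scaleC_left)
    have "?y \<notin> E" using ye yy by force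
    have "?P (insert ?y E)"
    proof (intro conjI)
      show "insert ?y E \<subseteq> S"
        using E y(1) complex_vector.subspace_scale[OF S] by blast
      show "orthonormal (insert ?y E)"
        using E yy ye \<open>?y \<notin> E\<close> unfolding orthonormal_def by auto
      have "Q ?y = c *\<^sub>C ?y"
        by (simp only: bounded_clinear_scaleC[OF Q] y(3) scaleC_scaleC mult.commute)
      then show "\<forall>x\<in>insert ?y E. \<exists>c. Q x = c *\<^sub>C x" using E by blast
    qed
    from maxE[OF this] show False using fin \<open>?y \<notin> E\<close> by simp
  qed
  have "x = (\<Sum>e\<in>E. cinner e x *\<^sub>C e)" if x: "x \<in> S" for x
  proof -
    let ?s = "\<Sum>e\<in>E. cinner e x *\<^sub>C e"
    have "?s \<in> S"
      using E by (intro complex_vector.subspace_sum[OF S] complex_vector.subspace_scale[OF S]) blast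
    moreover have "cinner f (x - ?s) = 0" if f: "f \<in> E" for f
    proof -
      have "cinner f ?s = (\<Sum>e\<in>E. if f = e then cinner e x else 0)"
        unfolding cinner_sum_right cinner_scaleC_right
        using E f by (intro sum.cong) (auto simp: orthonormal_def)
      then show ?thesis using f fin by (simp add: cinner_diff_right)
    qed
    ultimately have "x - ?s \<in> ?T" using x complex_vector.subspace_diff[OF S] by blast
    then show ?thesis using T0 by fastforce
  qed
  then show ?thesis using E fin by blast
qed

text \<open>Irreducibility speaks of closed subspaces only. The eigenbasis of the zero operator is
  an orthonormal basis of the span, which then becomes the set where two continuous maps
  agree.\<close>

lemma finite_span_closed:
  fixes B :: "'a::complex_hilbert_space set"
  assumes "finite B"
  shows "closed (complex_vector.span B)"
proof -
  obtain E where E: "finite E" "E \<subseteq> complex_vector.span B"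
    "\<And>x. x \<in> complex_vector.span B \<Longrightarrow> x = (\<Sum>e\<in>E. cinner e x *\<^sub>C e)"
    using orthonormal_eigenbasis[of "\<lambda>x. 0::'a" "complex_vector.span B" B] assms
    by (auto simp: bounded_clinear_def complex_vector.span_zero)
  have "complex_vector.span B = {x. x = (\<Sum>e\<in>E. cinner e x *\<^sub>C e)}"
  proof safe
    fix x assume x: "x = (\<Sum>e\<in>E. cinner e x *\<^sub>C e)"
    show "x \<in> complex_vector.span B"
      by (subst x) (use E(2) in \<open>blast intro: complex_vector.span_sum complex_vector.span_scale\<close>)
  qed (rule E(3))
  moreover have "closed {x. x = (\<Sum>e\<in>E. cinner e x *\<^sub>C e)}"
    by (intro closed_Collect_eq continuous_intros
        bounded_linear.continuous_on[OF bounded_linear_scaleC_left]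
        bounded_linear.continuous_on[OF bounded_linear_cinner_right])
  ultimately show ?thesis by simp
qed

lemma orthonormal_basis_expansion:
  fixes e :: "nat \<Rightarrow> 'a::complex_hilbert_space"
  assumes "orthonormal_basis e"
  shows "x = (\<Sum>i < cdim TYPE('a). cinner (e i) x *\<^sub>C e i)"
proof -
  let ?n = "cdim TYPE('a)"
  have on: "cinner (e i) (e j) = (if i = j then 1 else 0)" if "i < ?n" "j < ?n" for i j
    using assms that by (simp add: orthonormal_basis_def)
  have "x \<in> complex_vector.span (e ` {..<?n})"
    using assms by (simp add: orthonormal_basis_def)
  then show ?thesis
  proof (induction rule: complex_vector.span_induct_alt)
    case (step c y z)
    then obtain k where k: "k < ?n" "y = e k" by auto
    have "(\<Sum>i<?n. cinner (e i) (c *\<^sub>C y + z) *\<^sub>C e i)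
        = (\<Sum>i<?n. (if i = k then c *\<^sub>C e i else 0) + cinner (e i) z *\<^sub>C e i)"
      using k by (intro sum.cong) (auto simp: cinner_add_right cinner_scaleC_right on scaleC_add_left)
    also have "\<dots> = c *\<^sub>C y + z"
      using k step(2) by (simp add: sum.distrib)
    finally show ?case by simp
  qed simp
qed

lemma parseval:
  fixes e :: "nat \<Rightarrow> 'a::complex_hilbert_space"
  assumes "orthonormal_basis e"
  shows "cinner x y = (\<Sum>i < cdim TYPE('a). cinner x (e i) * cinner (e i) y)"
  by (subst orthonormal_basis_expansion[OF assms, of y])
    (simp add: cinner_sum_right cinner_scaleC_right mult.commute)

theorem spectral_theorem:
  fixes Q :: "'a::complex_hilbert_space \<Rightarrow> 'a"
  assumes fin: "finite_cdim TYPE('a)"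
    and Q: "bounded_clinear Q" and sa: "\<And>x y. cinner (Q x) y = cinner x (Q y)"
  shows "\<exists>\<mu> \<psi>. spectral_decomposition Q \<mu> \<psi>"
proof -
  let ?n = "cdim TYPE('a)"
  obtain B :: "'a set" where B: "finite B" "complex_vector.span B = UNIV"
    using fin by (auto simp: finite_cdim_def)
  obtain E where E: "finite E" "orthonormal E" "\<forall>x\<in>E. \<exists>c. Q x = c *\<^sub>C x"
    and exp: "\<And>x. x = (\<Sum>e\<in>E. cinner e x *\<^sub>C e)"
    using orthonormal_eigenbasis[OF Q sa, of UNIV B] B by auto
  have span: "complex_vector.span E = UNIV"
  proof safe
    fix x
    show "x \<in> complex_vector.span E"
      by (subst exp)
        (blast intro: complex_vector.span_sum complex_vector.span_scale complex_vector.span_base)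
  qed simp
  have "card E = ?n"
    unfolding cdim_def
    by (rule complex_vector.dim_eq_card[symmetric])
      (simp_all add: span orthonormal_independent[OF E(2)])
  then obtain \<psi> where \<psi>: "bij_betw \<psi> {..<?n} E"
    using E(1) ex_bij_betw_nat_finite[of E] by (auto simp: atLeast0LessThan)
  have onb: "orthonormal_basis \<psi>"
    unfolding orthonormal_basis_def
    using E(2) span \<psi> by (auto simp: orthonormal_def bij_betw_def inj_on_eq_iff)
  \<comment> \<open>Self-adjointness makes each eigenvalue real, so passing to the real part loses
    nothing.\<close>
  define \<mu> where "\<mu> j = Re (cinner (\<psi> j) (Q (\<psi> j)))" for j
  have eig: "Q (\<psi> j) = of_real (\<mu> j) *\<^sub>C \<psi> j" if j: "j < ?n" for j
  proof -
    obtain c where c: "Q (\<psi> j) = c *\<^sub>C \<psi> j" using E(3) \<psi> j bij_betwE by blast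
    have "cinner (\<psi> j) (\<psi> j) = 1" using onb j by (simp add: orthonormal_basis_def)
    then have "cinner (\<psi> j) (Q (\<psi> j)) = c" "cnj c = c"
      using sa[of "\<psi> j" "\<psi> j"] by (simp_all add: c cinner_scaleC_right cinner_scaleC_left)
    then show ?thesis
      by (simp add: \<mu>_def c) (metis complex_is_Real_iff Reals_cnj_iff of_real_Re)
  qed
  have "Q \<phi> = (\<Sum>j<?n. of_real (\<mu> j) *\<^sub>C cinner (\<psi> j) \<phi> *\<^sub>C \<psi> j)" for \<phi>
    by (subst orthonormal_basis_expansion[OF onb, of \<phi>])
      (auto simp: bounded_clinear_sum[OF Q] bounded_clinear_scaleC[OF Q] eig scaleC_scaleC
        mult.commute intro!: sum.cong)
  then show ?thesis using onb unfolding spectral_decomposition_def by blast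
qed

lemma orthonormal_basis_exists:
  assumes "finite_cdim TYPE('a::complex_hilbert_space)"
  shows "\<exists>e :: nat \<Rightarrow> 'a. orthonormal_basis e"
  using spectral_theorem[OF assms, of "\<lambda>x. 0"]
  by (auto simp: bounded_clinear_def spectral_decomposition_def)

text \<open>Polarization of the real quadratic form.\<close>

lemma positive_op_selfadjoint:
  assumes "positive_op Q"
  shows "cinner (Q x) y = cinner x (Q y)"
proof -
  note Q = bounded_clinear_simps[of Q]
  have bcl: "bounded_clinear Q" and r: "\<And>x. cinner x (Q x) \<in> \<real>"
    using assms nonneg_Reals_subset_Reals by (auto simp: positive_op_def)
  have sym: "cinner (Q z) z = cinner z (Q z)" for z
    using r[of z] cinner_commute[of "Q z" z] by (simp add: Reals_cnj_iff)
  have 1: "cinner (Q x) y + cinner (Q y) x = cinner x (Q y) + cinner y (Q x)"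
    using sym[of "x + y"] sym[of x] sym[of y]
    by (simp add: Q[OF bcl] cinner_add_left cinner_add_right add.commute)
  have "\<i> * (cinner (Q x) y - cinner (Q y) x) = \<i> * (cinner x (Q y) - cinner y (Q x))"
    using sym[of "x + \<i> *\<^sub>C y"] sym[of x] sym[of y]
    by (simp add: Q[OF bcl] cinner_add_left cinner_add_right cinner_scaleC_left cinner_scaleC_right
        algebra_simps)
  then have "cinner (Q x) y - cinner (Q y) x = cinner x (Q y) - cinner y (Q x)" by simp
  from arg_cong2[of _ _ _ _ "(+)", OF 1 this] show ?thesis by simp
qed

lemma spectral_decomposition_eigenvector:
  fixes Q :: "'a::complex_hilbert_space \<Rightarrow> 'a"
  assumes "spectral_decomposition Q \<mu> \<psi>" "j < cdim TYPE('a)"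
  shows "Q (\<psi> j) = of_real (\<mu> j) *\<^sub>C \<psi> j"
proof -
  have "Q (\<psi> j) = (\<Sum>i<cdim TYPE('a). of_real (\<mu> i) *\<^sub>C cinner (\<psi> i) (\<psi> j) *\<^sub>C \<psi> i)"
    using assms(1) by (auto simp: spectral_decomposition_def)
  also have "\<dots> = (\<Sum>i<cdim TYPE('a). if i = j then of_real (\<mu> j) *\<^sub>C \<psi> j else 0)"
    using assms by (intro sum.cong) (auto simp: spectral_decomposition_def orthonormal_basis_def)
  finally show ?thesis using assms(2) by simp
qed

lemma symbol_eigenvalue_bounds:
  fixes Q :: "'a::complex_hilbert_space \<Rightarrow> 'a"
  assumes "Q \<in> symbols" "spectral_decomposition Q \<mu> \<psi>" "j < cdim TYPE('a)"
  shows "0 \<le> \<mu> j" "\<mu> j \<le> 1"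
proof -
  have "cinner (\<psi> j) (\<psi> j) = 1"
    using assms(2,3) by (simp add: spectral_decomposition_def orthonormal_basis_def)
  then have "cinner (\<psi> j) (Q (\<psi> j)) = of_real (\<mu> j)"
    "cinner (\<psi> j) (\<psi> j - Q (\<psi> j)) = of_real (1 - \<mu> j)"
    using spectral_decomposition_eigenvector[OF assms(2,3)]
    by (simp_all add: cinner_scaleC_right cinner_diff_right)
  moreover have "cinner (\<psi> j) (Q (\<psi> j)) \<in> \<real>\<^sub>\<ge>\<^sub>0" "cinner (\<psi> j) (\<psi> j - Q (\<psi> j)) \<in> \<real>\<^sub>\<ge>\<^sub>0"
    using assms(1) by (auto simp: symbols_def positive_op_def)
  ultimately show "0 \<le> \<mu> j" "\<mu> j \<le> 1" by (auto simp: complex_nonneg_Reals_iff)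
qed

section \<open>CAR fields\<close>

lemma eq_neg_self: "x = - x \<Longrightarrow> x = (0::'a::real_vector)"
  by (metis add.right_inverse scaleR_2 scaleR_eq_0_iff zero_neq_numeral)

lemma norm_eq_1_iff_cinner: "norm x = 1 \<longleftrightarrow> cinner x x = 1"
proof -
  have "cinner x x = 1 \<longleftrightarrow> (norm x)\<^sup>2 = 1"
    unfolding cinner_norm by (simp only: of_real_eq_1_iff)
  then show ?thesis by (simp add: power2_eq_1_iff) (metis norm_ge_zero not_one_le_zero neg_0_le_iff_le le_minus_one_simps(2))
qed

lemma bounded_clinear_image_span:
  assumes A: "bounded_clinear A" and "\<And>x. x \<in> B \<Longrightarrow> A x \<in> complex_vector.span C"
    and "x \<in> complex_vector.span B"
  shows "A x \<in> complex_vector.span C"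
  using assms(3)
proof (induction rule: complex_vector.span_induct_alt)
  case base
  then show ?case by (simp add: bounded_clinear_zero[OF A] complex_vector.span_zero)
next
  case (step c x y)
  then show ?case
    by (simp add: bounded_clinear_simps[OF A] complex_vector.span_add complex_vector.span_scale assms(2))
qed

text \<open>Results here hold in every representation; irreducibility enters with
  \<open>fock\<close>.\<close>

locale car_field =
  fixes Z :: "'h::complex_hilbert_space \<Rightarrow> 'k::complex_hilbert_space \<Rightarrow> 'k"
  assumes car: "CAR_field Z"
begin

abbreviation Zs :: "'h \<Rightarrow> 'k \<Rightarrow> 'k" where "Zs \<psi> \<equiv> adj (Z \<psi>)"

lemma bounded_clinear_Z: "bounded_clinear (Z \<psi>)"
  using car by (simp add: CAR_field_def)

lemma bounded_clinear_Zs: "bounded_clinear (Zs \<psi>)"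
  by (rule bounded_clinear_adj[OF bounded_clinear_Z])

lemmas Z_simps = bounded_clinear_simps[OF bounded_clinear_Z]
lemmas Zs_simps = bounded_clinear_simps[OF bounded_clinear_Zs]

lemma cinner_Zs_left: "cinner (Zs \<psi> x) y = cinner x (Z \<psi> y)"
  by (rule cinner_adj_left[OF bounded_clinear_Z])

lemma cinner_Zs_right: "cinner x (Zs \<psi> y) = cinner (Z \<psi> x) y"
  by (rule cinner_adj_right[OF bounded_clinear_Z])

lemma Z_add: "Z (\<psi> + \<phi>) x = Z \<psi> x + Z \<phi> x"
  using car by (simp add: CAR_field_def)

lemma Z_scale: "Z (c *\<^sub>C \<psi>) x = cnj c *\<^sub>C Z \<psi> x"
  using car by (simp add: CAR_field_def)

lemma Zs_add: "Zs (\<psi> + \<phi>) x = Zs \<psi> x + Zs \<phi> x"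
  by (rule cinner_extensionality_left) (simp add: cinner_Zs_left cinner_add_left cinner_add_right Z_add)

lemma Zs_scale: "Zs (c *\<^sub>C \<psi>) x = c *\<^sub>C Zs \<psi> x"
  by (rule cinner_extensionality_left)
    (simp add: cinner_Zs_left cinner_scaleC_left cinner_scaleC_right Z_scale)

lemma Z_zero: "Z 0 x = 0"
  using Z_add[of 0 0 x] by simp

lemma Zs_zero: "Zs 0 x = 0"
  using Zs_add[of 0 0 x] by simp

lemma Z_sum: "Z (\<Sum>i\<in>I. f i) x = (\<Sum>i\<in>I. Z (f i) x)"
  by (induction I rule: infinite_finite_induct) (simp_all add: Z_zero Z_add)

lemma Zs_sum: "Zs (\<Sum>i\<in>I. f i) x = (\<Sum>i\<in>I. Zs (f i) x)"
  by (induction I rule: infinite_finite_induct) (simp_all add: Zs_zero Zs_add)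

text \<open>Oriented as normal ordering: annihilators move to the right, where they meet the
  vacuum.\<close>

lemma Z_Zs: "Z \<psi> (Zs \<phi> x) = cinner \<psi> \<phi> *\<^sub>C x - Zs \<phi> (Z \<psi> x)"
proof -
  have "Z \<psi> (Zs \<phi> x) + Zs \<phi> (Z \<psi> x) = cinner \<psi> \<phi> *\<^sub>C x"
    using car unfolding CAR_field_def by blast
  then show ?thesis by (simp add: algebra_simps)
qed

lemma Z_anticommute: "Z \<psi> (Z \<phi> x) = - Z \<phi> (Z \<psi> x)"
proof -
  have "Z \<psi> (Z \<phi> x) + Z \<phi> (Z \<psi> x) = 0"
    using car unfolding CAR_field_def by blast
  then show ?thesis by (simp add: eq_neg_iff_add_eq_0)
qed

lemma Zs_anticommute: "Zs \<psi> (Zs \<phi> x) = - Zs \<phi> (Zs \<psi> x)"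
  by (rule cinner_extensionality_left)
    (simp add: cinner_Zs_left cinner_minus_left Z_anticommute[of \<phi> \<psi>] cinner_minus_right)

lemma Z_square: "Z \<psi> (Z \<psi> x) = 0"
  by (rule eq_neg_self[OF Z_anticommute])

lemma Zs_square: "Zs \<psi> (Zs \<psi> x) = 0"
  by (rule eq_neg_self[OF Zs_anticommute])

section \<open>Gaussian factors and their products\<close>

lemma bounded_clinear_gaussian_factor: "bounded_clinear (gaussian_factor Z m \<psi>)"
  using bounded_clinear_plus[OF
      bounded_clinear_scale[OF bounded_clinear_compose[OF bounded_clinear_Z bounded_clinear_Zs]]
      bounded_clinear_scale[OF bounded_clinear_compose[OF bounded_clinear_Zs bounded_clinear_Z]]]
  by (simp add: gaussian_factor_def)

text \<open>By orthogonality \<open>Z \<psi>\<close> anticommutes with \<open>Z \<phi>\<close> and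
  with its adjoint. The factor is quadratic in these, so the signs cancel.\<close>

lemma gaussian_factor_commute_Z:
  assumes "cinner \<psi> \<phi> = 0"
  shows "gaussian_factor Z m \<phi> (Z \<psi> x) = Z \<psi> (gaussian_factor Z m \<phi> x)"
proof -
  have *: "cinner \<phi> \<psi> = 0" using assms cinner_commute[of \<phi> \<psi>] by simp
  have "Zs \<phi> (Z \<psi> y) = - Z \<psi> (Zs \<phi> y)" for y
    using Z_Zs[of \<psi> \<phi> y] assms by simp
  then show ?thesis
    unfolding gaussian_factor_def
    by (simp add: Z_anticommute[of \<phi> \<psi>] Z_simps Zs_simps)
qed

lemma gaussian_factor_commute_Zs:
  assumes "cinner \<psi> \<phi> = 0"
  shows "gaussian_factor Z m \<phi> (Zs \<psi> x) = Zs \<psi> (gaussian_factor Z m \<phi> x)"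
proof -
  have "cinner \<phi> \<psi> = 0" using assms cinner_commute[of \<phi> \<psi>] by simp
  then have "Z \<phi> (Zs \<psi> y) = - Zs \<psi> (Z \<phi> y)" for y
    using Z_Zs[of \<phi> \<psi> y] by simp
  then show ?thesis
    unfolding gaussian_factor_def
    by (simp add: Zs_anticommute[of \<phi> \<psi>] Z_simps Zs_simps)
qed

text \<open>At occupation 1/2 both terms have coefficient 1, and the anticommutation relation adds
  them up to the identity. Such modes drop out of the product.\<close>

lemma gaussian_factor_half:
  assumes "cinner \<psi> \<psi> = 1"
  shows "gaussian_factor Z (1/2) \<psi> = id"
  using assms by (auto simp: gaussian_factor_def Z_Zs)

text \<open>A unit eigenvector on a given line is determined only up to a phase, which must not
  affect the factor.\<close>

lemma gaussian_factor_scale: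
  assumes "cmod c = 1"
  shows "gaussian_factor Z m (c *\<^sub>C \<psi>) = gaussian_factor Z m \<psi>"
proof -
  have "cnj c * c = 1" "c * cnj c = 1"
    using complex_norm_square[of c] assms by (simp_all add: mult.commute)
  then show ?thesis
    by (simp add: fun_eq_iff gaussian_factor_def Z_scale Zs_scale Z_simps Zs_simps scaleC_scaleC)
qed

text \<open>The reason why mixtures of the two prepared states remain Gaussian.\<close>

lemma gaussian_factor_interpolate:
  "gaussian_factor Z p \<psi> x
     = of_real p *\<^sub>C gaussian_factor Z 1 \<psi> x + of_real (1 - p) *\<^sub>C gaussian_factor Z 0 \<psi> x"
  by (simp add: gaussian_factor_def scaleC_scaleC mult_ac)

text \<open>Exhibits the matrix elements as entries of a Gram matrix, the form in which complete
  positivity uses them.\<close>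

lemma cinner_gaussian_factor_1: "cinner x (gaussian_factor Z 1 \<psi> y) = 2 * cinner (Z \<psi> x) (Z \<psi> y)"
  by (simp add: gaussian_factor_def cinner_scaleC_right cinner_Zs_right)

lemma cinner_gaussian_factor_0: "cinner x (gaussian_factor Z 0 \<psi> y) = 2 * cinner (Zs \<psi> x) (Zs \<psi> y)"
  by (simp add: gaussian_factor_def cinner_scaleC_right cinner_Zs_left)

lemma gaussian_factor_in_CAR_algebra: "gaussian_factor Z m \<psi> \<in> CAR_algebra Z"
proof -
  have Z: "Z \<psi> \<in> CAR_algebra Z" unfolding CAR_algebra_def by (rule star_algebra.gen) simp
  then have Zs: "Zs \<psi> \<in> CAR_algebra Z" unfolding CAR_algebra_def by (rule star_algebra.star)
  have "(\<lambda>x. a *\<^sub>C (Z \<psi> \<circ> Zs \<psi>) x + b *\<^sub>C (Zs \<psi> \<circ> Z \<psi>) x) \<in> CAR_algebra Z" for a b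
    using Z Zs unfolding CAR_algebra_def
    by (intro star_algebra.add star_algebra.scale star_algebra.mult)
  then show ?thesis by (simp add: gaussian_factor_def)
qed

lemma CAR_algebra_bounded_clinear: "A \<in> CAR_algebra Z \<Longrightarrow> bounded_clinear A"
  unfolding CAR_algebra_def
  by (rule star_algebra_bounded_clinear) (auto simp: bounded_clinear_Z)

text \<open>The fold from \<open>gaussian_state\<close>, over an arbitrary list of modes so that
  induction applies.\<close>

definition gaussian_product :: "(nat \<Rightarrow> real) \<Rightarrow> (nat \<Rightarrow> 'h) \<Rightarrow> nat list \<Rightarrow> 'k \<Rightarrow> 'k" where
  "gaussian_product \<mu> \<psi> js = foldr (\<lambda>j R. gaussian_factor Z (\<mu> j) (\<psi> j) \<circ> R) js id"

lemma gaussian_product_Nil [simp]: "gaussian_product \<mu> \<psi> [] = id"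
  by (simp add: gaussian_product_def)

lemma gaussian_product_Cons [simp]:
  "gaussian_product \<mu> \<psi> (j # js) = gaussian_factor Z (\<mu> j) (\<psi> j) \<circ> gaussian_product \<mu> \<psi> js"
  by (simp add: gaussian_product_def)

lemma bounded_clinear_gaussian_product: "bounded_clinear (gaussian_product \<mu> \<psi> js)"
proof (induction js)
  case (Cons j js)
  then show ?case
    unfolding gaussian_product_Cons by (intro bounded_clinear_compose bounded_clinear_gaussian_factor)
qed (use bounded_clinear_id in \<open>simp add: id_def\<close>)

lemma gaussian_product_commute_Z:
  assumes "\<And>j. j \<in> set js \<Longrightarrow> cinner \<phi> (\<psi> j) = 0"
  shows "gaussian_product \<mu> \<psi> js (Z \<phi> x) = Z \<phi> (gaussian_product \<mu> \<psi> js x)"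
  using assms by (induction js) (simp_all add: gaussian_factor_commute_Z)

lemma gaussian_product_commute_Zs:
  assumes "\<And>j. j \<in> set js \<Longrightarrow> cinner \<phi> (\<psi> j) = 0"
  shows "gaussian_product \<mu> \<psi> js (Zs \<phi> x) = Zs \<phi> (gaussian_product \<mu> \<psi> js x)"
  using assms by (induction js) (simp_all add: gaussian_factor_commute_Zs)

lemma gaussian_product_single:
  assumes "distinct js" "k \<in> set js"
    and "\<And>j. j \<in> set js \<Longrightarrow> j \<noteq> k \<Longrightarrow> gaussian_factor Z (\<mu> j) (\<psi> j) = id"
  shows "gaussian_product \<mu> \<psi> js = gaussian_factor Z (\<mu> k) (\<psi> k)"
proof -
  have id: "gaussian_product \<mu> \<psi> ls = id"
    if "\<And>j. j \<in> set ls \<Longrightarrow> gaussian_factor Z (\<mu> j) (\<psi> j) = id" for ls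
    using that by (induction ls) simp_all
  show ?thesis using assms
  proof (induction js)
    case (Cons j js)
    show ?case
    proof (cases "j = k")
      case True
      then have "gaussian_product \<mu> \<psi> js = id" using Cons.prems
        by (intro id) (metis distinct.simps(2) list.set_intros(2))
      then show ?thesis using True by simp
    qed (use Cons in simp)
  qed simp
qed

text \<open>The spectral theorem makes the choice in \<open>gaussian_state\<close> nonempty. Nothing
  is learnt about which decomposition was chosen.\<close>

lemma gaussian_state_product:
  assumes "finite_cdim TYPE('h)" "positive_op Q"
  shows "\<exists>\<mu> \<psi>. spectral_decomposition Q \<mu> \<psi> \<and>
           gaussian_state Z Q = gaussian_product \<mu> \<psi> [0..<cdim TYPE('h)]"
proof -
  have "\<exists>\<rho> \<mu> \<psi>. spectral_decomposition Q \<mu> \<psi> \<and> \<rho> = gaussian_product \<mu> \<psi> [0..<cdim TYPE('h)]"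
    using spectral_theorem[OF assms(1), of Q] positive_op_selfadjoint[OF assms(2)] assms(2)
    by (auto simp: positive_op_def)
  then show ?thesis
    unfolding gaussian_state_def gaussian_product_def by (rule someI_ex)
qed

end

text \<open>The symbol of the Gaussian state whose only factor different from the identity is
  \<open>gaussian_factor Z p u\<close>.\<close>

definition one_mode_symbol :: "real \<Rightarrow> 'h::complex_hilbert_space \<Rightarrow> 'h \<Rightarrow> 'h" where
  "one_mode_symbol p u x = (1/2) *\<^sub>C x + (of_real (p - 1/2) * cinner u x) *\<^sub>C u"

lemma bounded_clinear_one_mode_symbol: "bounded_clinear (one_mode_symbol p u)"
  using bounded_clinear_plus[OF bounded_clinear_scale[OF bounded_clinear_id, of "1/2"]
      bounded_clinear_scale[OF bounded_clinear_rank_one, of "of_real (p - 1/2)" u u]]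
  by (simp add: one_mode_symbol_def[abs_def] scaleC_scaleC)

text \<open>Reduces the upper bound in \<open>symbols\<close> to the lower bound, with
  \<open>1 - p\<close> in place of \<open>p\<close>.\<close>

lemma one_mode_symbol_complement:
  "x - one_mode_symbol p u x = one_mode_symbol (1 - p) u x"
proof -
  have "x = (1/2) *\<^sub>C x + (1/2) *\<^sub>C x"
    by (simp flip: scaleC_add_left)
  then have "x - (1/2) *\<^sub>C x = (1/2) *\<^sub>C x" by (metis add_diff_cancel)
  moreover have "- ((of_real (p - 1/2) * cinner u x) *\<^sub>C u) = (of_real ((1 - p) - 1/2) * cinner u x) *\<^sub>C u"
    unfolding complex_vector.scale_minus_left[symmetric] by (simp add: algebra_simps)
  ultimately show ?thesis
    unfolding one_mode_symbol_def by (metis diff_diff_eq add_uminus_conv_diff)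
qed

lemma positive_one_mode_symbol:
  assumes "norm u = 1" "0 \<le> p"
  shows "positive_op (one_mode_symbol p u)"
  unfolding positive_op_def
proof (intro conjI allI bounded_clinear_one_mode_symbol)
  fix x
  have "cinner x (one_mode_symbol p u x)
      = of_real ((norm x)\<^sup>2 / 2) + of_real (p - 1/2) * (cinner u x * cinner x u)"
    by (simp add: one_mode_symbol_def cinner_add_right cinner_scaleC_right cinner_norm)
  \<comment> \<open>Regrouped by eigenspaces: weight 1/2 on the part orthogonal to \<open>u\<close>,
    weight \<open>p\<close> along \<open>u\<close>.\<close>
  also have "\<dots> = of_real (((norm x)\<^sup>2 - (cmod (cinner u x))\<^sup>2) / 2 + p * (cmod (cinner u x))\<^sup>2)"
    unfolding mult_cinner_commute by (simp add: field_simps)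
  finally have *: "cinner x (one_mode_symbol p u x)
      = of_real (((norm x)\<^sup>2 - (cmod (cinner u x))\<^sup>2) / 2 + p * (cmod (cinner u x))\<^sup>2)" .
  have "(cmod (cinner u x))\<^sup>2 \<le> (norm x)\<^sup>2"
    using norm_cinner_le[of u x] assms(1) by (intro power_mono) simp_all
  then show "cinner x (one_mode_symbol p u x) \<in> \<real>\<^sub>\<ge>\<^sub>0"
    unfolding * using assms(2) by (intro iffD2[OF nonneg_Reals_of_real_iff]) simp
qed

lemma one_mode_symbol_in_symbols:
  "norm u = 1 \<Longrightarrow> 0 \<le> p \<Longrightarrow> p \<le> 1 \<Longrightarrow> one_mode_symbol p u \<in> symbols"
  using positive_one_mode_symbol[of u p] positive_one_mode_symbol[of u "1 - p"]
  by (simp add: symbols_def one_mode_symbol_complement)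

text \<open>Subtracting 1/2 from the symbol leaves a multiple of the projection on \<open>u\<close>.
  For \<open>p \<noteq> 1/2\<close> every vector of the unknown eigenbasis is therefore either
  orthogonal to \<open>u\<close>, with eigenvalue 1/2 and trivial factor, or a phase times
  \<open>u\<close>, with eigenvalue \<open>p\<close>.\<close>

lemma (in car_field) gaussian_state_one_mode:
  assumes fin: "finite_cdim TYPE('h)" and u: "norm u = 1" and p: "0 \<le> p"
  shows "gaussian_state Z (one_mode_symbol p u) = gaussian_factor Z p u"
proof -
  let ?N = "cdim TYPE('h)"
  have uu: "cinner u u = 1" using u by (simp only: norm_eq_1_iff_cinner)
  obtain \<mu> \<psi> where sd: "spectral_decomposition (one_mode_symbol p u) \<mu> \<psi>"
    and gs: "gaussian_state Z (one_mode_symbol p u) = gaussian_product \<mu> \<psi> [0..<?N]"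
    using gaussian_state_product[OF fin positive_one_mode_symbol[OF u p]] by blast
  have onb: "orthonormal_basis \<psi>" using sd by (simp add: spectral_decomposition_def)
  have on: "cinner (\<psi> i) (\<psi> j) = (if i = j then 1 else 0)" if "i < ?N" "j < ?N" for i j
    using onb that by (simp add: orthonormal_basis_def)
  define q where "q = p - 1/2"
  define \<nu> where "\<nu> j = \<mu> j - 1/2" for j
  have eig: "of_real (\<nu> j) *\<^sub>C \<psi> j = (of_real q * cinner u (\<psi> j)) *\<^sub>C u" if "j < ?N" for j
  proof -
    have "of_real (\<nu> j) *\<^sub>C \<psi> j + (1/2) *\<^sub>C \<psi> j = of_real (\<mu> j) *\<^sub>C \<psi> j"
      by (simp add: \<nu>_def flip: scaleC_add_left)
    also have "\<dots> = (1/2) *\<^sub>C \<psi> j + (of_real q * cinner u (\<psi> j)) *\<^sub>C u"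
      using spectral_decomposition_eigenvector[OF sd that]
      by (simp only: one_mode_symbol_def q_def)
    finally show ?thesis by (metis add.commute add_left_cancel)
  qed
  have half: "gaussian_factor Z (\<mu> j) (\<psi> j) = id"
    if j: "j < ?N" and *: "q = 0 \<or> cinner u (\<psi> j) = 0" for j
  proof -
    have "\<psi> j \<noteq> 0" using on[OF j j] by auto
    moreover have "of_real (\<nu> j) *\<^sub>C \<psi> j = 0" using eig[OF j] * by auto
    ultimately have "\<nu> j = 0" by simp
    then have "\<mu> j = 1/2" by (simp add: \<nu>_def)
    then show ?thesis using gaussian_factor_half[of "\<psi> j"] on[OF j j] by metis
  qed
  have "\<exists>k<?N. cinner u (\<psi> k) \<noteq> 0"
  proof (rule ccontr)
    assume "\<not> ?thesis"
    then have "cinner (\<psi> k) u = 0" if "k < ?N" for k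
      using that cinner_commute[of "\<psi> k" u] by simp
    then have "cinner u u = 0"
      by (subst parseval[OF onb]) simp
    then show False using uu by simp
  qed
  then obtain k where k: "k < ?N" "cinner u (\<psi> k) \<noteq> 0" by blast
  show ?thesis
  \<comment> \<open>For \<open>q = 0\<close> the eigenbasis need not contain a multiple of
    \<open>u\<close>, but then all factors are the identity.\<close>
  proof (cases "q = 0")
    case True
    then have "gaussian_product \<mu> \<psi> [0..<?N] = gaussian_factor Z (\<mu> k) (\<psi> k)"
      using half k(1) by (intro gaussian_product_single) simp_all
    moreover have "p = 1/2" using True by (simp add: q_def)
    ultimately show ?thesis
      unfolding gs using True half[OF k(1)] gaussian_factor_half[OF uu] by metis
  next
    case False
    let ?a = "of_real q * cinner u (\<psi> k)"
    have a: "?a \<noteq> 0" using False k(2) by simp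
    have "u \<noteq> 0" using u by auto
    then have \<nu>k: "\<nu> k \<noteq> 0"
      using eig[OF k(1)] a by auto
    define c where "c = ?a / of_real (\<nu> k)"
    have "\<psi> k = (1 / of_real (\<nu> k)) *\<^sub>C of_real (\<nu> k) *\<^sub>C \<psi> k"
      using \<nu>k unfolding scaleC_scaleC by simp
    then have \<psi>k: "\<psi> k = c *\<^sub>C u"
      unfolding eig[OF k(1)] scaleC_scaleC c_def by simp
    have "c \<noteq> 0" using a \<nu>k by (simp add: c_def)
    have "norm (\<psi> k) = 1"
      using on[OF k(1) k(1)] by (simp add: norm_eq_1_iff_cinner)
    then have c1: "cmod c = 1"
      using u by (simp add: \<psi>k norm_scaleC)
    have "of_real (\<nu> k) * c = of_real q * c"
      using arg_cong[OF eig[OF k(1)], of "cinner u"] uu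
      by (simp add: \<psi>k cinner_scaleC_right)
    then have "\<mu> k = p"
      using \<open>c \<noteq> 0\<close> by (simp add: \<nu>_def q_def flip: of_real_diff)
    moreover have "gaussian_product \<mu> \<psi> [0..<?N] = gaussian_factor Z (\<mu> k) (\<psi> k)"
    proof (rule gaussian_product_single)
      fix j assume j: "j \<in> set [0..<?N]" "j \<noteq> k"
      then have "cinner (\<psi> k) (\<psi> j) = 0" using on k(1) by simp
      then have "cinner u (\<psi> j) = 0" using \<open>c \<noteq> 0\<close> by (simp add: \<psi>k cinner_scaleC_left)
      then show "gaussian_factor Z (\<mu> j) (\<psi> j) = id" using half j(1) by simp
    qed (use k in auto)
    ultimately show ?thesis
      using gs by (simp add: \<psi>k gaussian_factor_scale[OF c1])
  qed
qed

section \<open>Irreducible representations\<close>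

locale fock = car_field Z
  for Z :: "'h::complex_hilbert_space \<Rightarrow> 'k::complex_hilbert_space \<Rightarrow> 'k" +
  fixes e :: "nat \<Rightarrow> 'h" and \<Omega> :: 'k
  assumes irr: "acts_irreducibly Z"
    and onb: "orthonormal_basis e"
    and norm_vacuum: "norm \<Omega> = 1"
    and Z_vacuum: "Z \<psi> \<Omega> = 0"

text \<open>Start from any nonzero vector and treat the modes in turn. If \<open>Z (e k)\<close>
  does not kill \<open>x\<close>, replace \<open>x\<close> by \<open>Z (e k) x\<close>: it is killed
  by \<open>Z (e k)\<close> since squares vanish, and by the earlier annihilators since they
  anticommute with it.\<close>

lemma (in car_field) vacuum_exists:
  fixes e :: "nat \<Rightarrow> 'h"
  assumes onb: "orthonormal_basis e" and nontrivial: "(UNIV :: 'k set) \<noteq> {0}"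
  shows "\<exists>\<Omega>. norm \<Omega> = 1 \<and> (\<forall>\<psi>. Z \<psi> \<Omega> = 0)"
proof -
  let ?N = "cdim TYPE('h)"
  have "\<exists>x\<noteq>0. \<forall>j<k. Z (e j) x = 0" for k
  proof (induction k)
    case 0
    then show ?case using nontrivial by auto
  next
    case (Suc k)
    then obtain x where x: "x \<noteq> 0" "\<forall>j<k. Z (e j) x = 0" by blast
    show ?case
    proof (cases "Z (e k) x = 0")
      case True
      then show ?thesis using x by (auto simp: less_Suc_eq)
    next
      case False
      have "Z (e j) (Z (e k) x) = 0" if "j < Suc k" for j
        using that x(2) Z_square Z_anticommute[of "e j" "e k" x]
        by (auto simp: less_Suc_eq Z_simps)
      then show ?thesis using False by blast
    qed
  qed
  then obtain x where x: "x \<noteq> 0" "\<And>j. j < ?N \<Longrightarrow> Z (e j) x = 0" by blast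
  have "Z \<psi> x = 0" for \<psi>
    by (subst orthonormal_basis_expansion[OF onb, of \<psi>]) (simp add: Z_sum Z_scale x(2))
  then have "Z \<psi> (of_real (1 / norm x) *\<^sub>C x) = 0" for \<psi>
    by (simp only: Z_simps) simp
  moreover have "norm (complex_of_real (1 / norm x) *\<^sub>C x) = 1"
    using x(1) by (simp add: norm_scaleC norm_divide)
  ultimately show ?thesis by blast
qed

context fock
begin

section \<open>The vacuum and the span of its images under creators\<close>

lemma cinner_vacuum: "cinner \<Omega> \<Omega> = 1"
  using norm_vacuum by (simp only: norm_eq_1_iff_cinner)

lemma onb_eq: "i < cdim TYPE('h) \<Longrightarrow> j < cdim TYPE('h) \<Longrightarrow> cinner (e i) (e j) = (if i = j then 1 else 0)"
  using onb by (simp add: orthonormal_basis_def)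

text \<open>Products of creators on the vacuum, each of the first \<open>k\<close> modes at most
  once. The newest creator stands outermost, so inductions only have to move past that one.\<close>

primrec fock_set :: "nat \<Rightarrow> 'k set" where
  "fock_set 0 = {\<Omega>}"
| "fock_set (Suc k) = fock_set k \<union> Zs (e k) ` fock_set k"

lemma finite_fock_set: "finite (fock_set k)"
  by (induction k) simp_all

lemma fock_set_cases: "x \<in> fock_set k \<Longrightarrow> x = \<Omega> \<or> (\<exists>j<k. \<exists>y. x = Zs (e j) y)"
  by (induction k) (auto simp: less_Suc_eq)

lemma fock_set_span_Suc:
  assumes "x \<in> complex_vector.span (fock_set k)"
  shows "x \<in> complex_vector.span (fock_set (Suc k))"
    and "Zs (e k) x \<in> complex_vector.span (fock_set (Suc k))"
proof -
  show "x \<in> complex_vector.span (fock_set (Suc k))"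
    using assms complex_vector.span_mono[of "fock_set k" "fock_set (Suc k)"] by auto
  show "Zs (e k) x \<in> complex_vector.span (fock_set (Suc k))"
    using assms by (rule bounded_clinear_image_span[OF bounded_clinear_Zs, rotated])
      (simp add: complex_vector.span_base)
qed

text \<open>Moving \<open>Z \<psi>\<close> past the outermost creator leaves a scalar term and a
  term where it acts one level lower, down to the vacuum, which it kills.\<close>

lemma Z_fock_span:
  "x \<in> complex_vector.span (fock_set k) \<Longrightarrow> Z \<psi> x \<in> complex_vector.span (fock_set k)"
proof (induction k arbitrary: x)
  case 0
  show ?case
    by (rule bounded_clinear_image_span[OF bounded_clinear_Z _ 0])
      (simp add: Z_vacuum complex_vector.span_zero)
next
  case (Suc k)
  show ?case
  proof (rule bounded_clinear_image_span[OF bounded_clinear_Z _ Suc.prems])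
    fix y assume "y \<in> fock_set (Suc k)"
    then consider "y \<in> fock_set k" | z where "z \<in> fock_set k" "y = Zs (e k) z" by auto
    then show "Z \<psi> y \<in> complex_vector.span (fock_set (Suc k))"
    proof cases
      case 1
      then show ?thesis
        by (intro fock_set_span_Suc Suc.IH complex_vector.span_base)
    next
      case 2
      then have "z \<in> complex_vector.span (fock_set k)" by (intro complex_vector.span_base)
      then show ?thesis
        unfolding 2(2) Z_Zs
        by (intro complex_vector.span_diff complex_vector.span_scale fock_set_span_Suc Suc.IH)
    qed
  qed
qed

text \<open>A repeated outermost creator gives 0; a different one anticommutes inwards, to the
  previous level.\<close>

lemma Zs_fock_span:
  "x \<in> complex_vector.span (fock_set k) \<Longrightarrow> j < k \<Longrightarrow> Zs (e j) x \<in> complex_vector.span (fock_set k)"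
proof (induction k arbitrary: x)
  case (Suc k)
  show ?case
  proof (rule bounded_clinear_image_span[OF bounded_clinear_Zs _ Suc.prems(1)])
    fix y assume "y \<in> fock_set (Suc k)"
    then consider "y \<in> fock_set k" | z where "z \<in> fock_set k" "y = Zs (e k) z" by auto
    then show "Zs (e j) y \<in> complex_vector.span (fock_set (Suc k))"
    proof cases
      case 1
      then have y: "y \<in> complex_vector.span (fock_set k)" by (intro complex_vector.span_base)
      show ?thesis
      proof (cases "j = k")
        case True
        then show ?thesis using y fock_set_span_Suc(2) by simp
      next
        case False
        then show ?thesis using y Suc.prems(2) Suc.IH[OF y] fock_set_span_Suc(1) by simp
      qed
    next
      case 2
      then have z: "z \<in> complex_vector.span (fock_set k)" by (intro complex_vector.span_base)
      show ?thesis
      proof (cases "j = k")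
        case True
        then show ?thesis by (simp add: 2(2) Zs_square complex_vector.span_zero)
      next
        case False
        then have "Zs (e j) z \<in> complex_vector.span (fock_set k)" using Suc.IH[OF z] Suc.prems(2) by simp
        then show ?thesis
          unfolding 2(2) Zs_anticommute[of "e j" "e k"]
          by (intro complex_vector.span_neg fock_set_span_Suc)
      qed
    qed
  qed
qed simp

text \<open>The span is closed, invariant and contains the nonzero vacuum, so irreducibility makes
  it everything. Finite dimension of the space is a consequence.\<close>

lemma fock_span_UNIV: "complex_vector.span (fock_set (cdim TYPE('h))) = UNIV"
proof -
  let ?S = "complex_vector.span (fock_set (cdim TYPE('h)))"
  have Zs: "Zs \<psi> x \<in> ?S" if "x \<in> ?S" for \<psi> x
    by (subst orthonormal_basis_expansion[OF onb, of \<psi>])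
      (auto simp: Zs_sum Zs_scale
        intro!: complex_vector.span_sum complex_vector.span_scale Zs_fock_span that)
  have "closed ?S \<and> complex_vector.subspace ?S \<and> (\<forall>\<psi>. \<forall>x\<in>?S. Z \<psi> x \<in> ?S \<and> Zs \<psi> x \<in> ?S)"
    by (intro conjI allI ballI finite_span_closed finite_fock_set complex_vector.subspace_span
        Z_fock_span Zs)
  then have "?S = {0} \<or> ?S = UNIV"
    using irr[unfolded acts_irreducibly_def, THEN conjunct2, THEN spec, of ?S] by (rule rev_mp)
  moreover have "\<Omega> \<in> fock_set k" for k by (induction k) simp_all
  then have "\<Omega> \<in> ?S" by (intro complex_vector.span_base)
  moreover have "\<Omega> \<noteq> 0" using norm_vacuum by auto
  ultimately show ?thesis by (metis singletonD)
qed

section \<open>Finite dimension and traces\<close>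

lemma finite_cdim_fock: "finite_cdim TYPE('k)"
  using fock_span_UNIV finite_fock_set unfolding finite_cdim_def by blast

text \<open>The very basis that \<open>trace_op\<close> chooses, named so that Parseval can be
  applied to it.\<close>

definition b :: "nat \<Rightarrow> 'k" where "b = (SOME b. orthonormal_basis b)"

lemma onb_b: "orthonormal_basis b"
  unfolding b_def using orthonormal_basis_exists[OF finite_cdim_fock] by (rule someI_ex)

lemma trace_eq: "trace_op A = (\<Sum>i<cdim TYPE('k). cinner (b i) (A (b i)))"
  by (simp add: trace_op_def b_def Let_def)

lemma trace_add: "trace_op (\<lambda>x. A x + B x) = trace_op A + trace_op (B :: 'k \<Rightarrow> 'k)"
  by (simp add: trace_eq cinner_add_right sum.distrib)

lemma trace_diff: "trace_op (\<lambda>x. A x - B x) = trace_op A - trace_op (B :: 'k \<Rightarrow> 'k)"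
  by (simp add: trace_eq cinner_diff_right sum_subtractf)

lemma trace_scale: "trace_op (\<lambda>x. c *\<^sub>C A x) = c * trace_op (A :: 'k \<Rightarrow> 'k)"
  by (simp add: trace_eq cinner_scaleC_right sum_distrib_left)

lemma trace_rank_one: "trace_op (\<lambda>x :: 'k. cinner v x *\<^sub>C w) = cinner v w"
  by (simp add: trace_eq cinner_scaleC_right parseval[OF onb_b, of v w])

lemma trace_id: "trace_op (\<lambda>x :: 'k. x) = of_nat (cdim TYPE('k))"
  using onb_b by (simp add: trace_eq orthonormal_basis_def)

lemma trace_commute:
  assumes A: "bounded_clinear A" and B: "bounded_clinear (B :: 'k \<Rightarrow> 'k)"
  shows "trace_op (\<lambda>x. A (B x)) = trace_op (\<lambda>x. B (A x))"
proof -
  have *: "cinner (b i) (C (D (b i))) = (\<Sum>j<cdim TYPE('k). cinner (b i) (C (b j)) * cinner (b j) (D (b i)))"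
    if C: "bounded_clinear C" for C D :: "'k \<Rightarrow> 'k" and i
    using parseval[OF onb_b, of "adj C (b i)" "D (b i)"] by (simp add: cinner_adj_left[OF C])
  have "trace_op (\<lambda>x. A (B x)) = (\<Sum>i<cdim TYPE('k). \<Sum>j<cdim TYPE('k). cinner (b i) (A (b j)) * cinner (b j) (B (b i)))"
    unfolding trace_eq *[OF A] ..
  also have "\<dots> = (\<Sum>j<cdim TYPE('k). \<Sum>i<cdim TYPE('k). cinner (b i) (A (b j)) * cinner (b j) (B (b i)))"
    by (rule sum.swap)
  also have "\<dots> = trace_op (\<lambda>x. B (A x))"
    unfolding trace_eq *[OF B] by (simp only: mult.commute)
  finally show ?thesis .
qed

text \<open>Cyclicity and the commutation with \<open>R\<close> give both orderings of
  \<open>Z \<psi>\<close> and its adjoint the same trace against \<open>R\<close>, so each is half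
  the trace of \<open>R\<close>. The two weights add up to 2 for every \<open>m\<close>.\<close>

lemma trace_gaussian_factor:
  assumes R: "bounded_clinear R" and com: "\<And>x. R (Z \<psi> x) = Z \<psi> (R x)"
    and \<psi>: "cinner \<psi> \<psi> = 1"
  shows "trace_op (\<lambda>x. gaussian_factor Z m \<psi> (R x)) = trace_op R"
proof -
  let ?t = "trace_op (\<lambda>x. Zs \<psi> (Z \<psi> (R x)))"
  have "trace_op (\<lambda>x. Z \<psi> ((Zs \<psi> \<circ> R) x)) = trace_op (\<lambda>x. (Zs \<psi> \<circ> R) (Z \<psi> x))"
    by (intro trace_commute bounded_clinear_Z bounded_clinear_compose bounded_clinear_Zs R)
  then have t: "trace_op (\<lambda>x. Z \<psi> (Zs \<psi> (R x))) = ?t"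
    by (simp add: com)
  have "trace_op R = trace_op (\<lambda>x. Z \<psi> (Zs \<psi> (R x)) + Zs \<psi> (Z \<psi> (R x)))"
    using \<psi> by (simp add: Z_Zs)
  also have "\<dots> = ?t + ?t" by (simp add: trace_add t)
  finally have R: "trace_op R = ?t + ?t" .
  have "trace_op (\<lambda>x. gaussian_factor Z m \<psi> (R x)) = of_real ((1 - m) * 2) * ?t + of_real (m * 2) * ?t"
    unfolding gaussian_factor_def trace_add trace_scale t ..
  then show ?thesis by (simp add: R algebra_simps)
qed

lemma trace_gaussian_product:
  assumes \<psi>: "orthonormal_basis \<psi>" and "distinct js" "set js \<subseteq> {..<cdim TYPE('h)}"
  shows "trace_op (gaussian_product \<mu> \<psi> js) = of_nat (cdim TYPE('k))"
  using assms(2,3)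
proof (induction js)
  case Nil
  then show ?case by (simp add: id_def trace_id)
next
  case (Cons j js)
  have on: "cinner (\<psi> i) (\<psi> k) = (if i = k then 1 else 0)" if "i < cdim TYPE('h)" "k < cdim TYPE('h)" for i k
    using \<psi> that by (simp add: orthonormal_basis_def)
  have "trace_op (\<lambda>x. gaussian_factor Z (\<mu> j) (\<psi> j) (gaussian_product \<mu> \<psi> js x))
      = trace_op (gaussian_product \<mu> \<psi> js)"
  proof (rule trace_gaussian_factor[OF bounded_clinear_gaussian_product])
    show "gaussian_product \<mu> \<psi> js (Z (\<psi> j) x) = Z (\<psi> j) (gaussian_product \<mu> \<psi> js x)" for x
      using Cons.prems on by (intro gaussian_product_commute_Z) (auto simp: subset_iff)
  qed (use Cons.prems on in auto)
  then show ?case using Cons by (simp add: comp_def)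
qed

text \<open>On the vacuum the occupied term of each factor vanishes and the empty one acts as a
  scalar.\<close>

lemma gaussian_product_vacuum:
  assumes \<psi>: "orthonormal_basis \<psi>" and "distinct js" "set js \<subseteq> {..<cdim TYPE('h)}"
  shows "gaussian_product \<mu> \<psi> js \<Omega> = of_real (\<Prod>j\<in>set js. 2 * (1 - \<mu> j)) *\<^sub>C \<Omega>"
  using assms(2,3)
proof (induction js)
  case (Cons j js)
  have "gaussian_factor Z (\<mu> j) (\<psi> j) \<Omega> = of_real (2 * (1 - \<mu> j)) *\<^sub>C \<Omega>"
    using \<psi> Cons.prems
    by (simp add: gaussian_factor_def Z_vacuum Z_Zs Zs_simps orthonormal_basis_def mult.commute)
  then show ?case
    using Cons by (simp add: bounded_clinear_scaleC[OF bounded_clinear_gaussian_factor] scaleC_scaleC mult_ac)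
qed simp

text \<open>Factors of other modes let the creator pass; the factor of mode \<open>k\<close> at
  occupation 0 ends in the same creator, whose square is 0.\<close>

lemma gaussian_product_zero_Zs:
  assumes "distinct js" "set js \<subseteq> {..<cdim TYPE('h)}" "k \<in> set js"
  shows "gaussian_product (\<lambda>j. 0) e js (Zs (e k) y) = 0"
  using assms
proof (induction js)
  case (Cons j js)
  show ?case
  proof (cases "k \<in> set js")
    case True
    then show ?thesis
      using Cons by (simp add: bounded_clinear_zero[OF bounded_clinear_gaussian_factor])
  next
    case False
    then have "k = j" using Cons.prems by simp
    moreover have "gaussian_product (\<lambda>j. 0) e js (Zs (e k) y) = Zs (e k) (gaussian_product (\<lambda>j. 0) e js y)"
      using False Cons.prems by (intro gaussian_product_commute_Zs) (auto simp: onb_eq)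
    ultimately show ?thesis
      by (simp add: gaussian_factor_def Zs_square Z_simps)
  qed
qed simp

text \<open>The Gaussian state with symbol \<open>0\<close> is the multiple \<open>2 ^ N\<close> of the vacuum projection; comparing
  traces gives the dimension.\<close>

lemma gaussian_product_zero:
  "gaussian_product (\<lambda>j. 0) e [0..<cdim TYPE('h)] x = (2 ^ cdim TYPE('h) * cinner \<Omega> x) *\<^sub>C \<Omega>"
proof -
  let ?G = "gaussian_product (\<lambda>j. 0) e [0..<cdim TYPE('h)]"
  have "x \<in> complex_vector.span (fock_set (cdim TYPE('h)))" by (simp add: fock_span_UNIV)
  then show ?thesis
  proof (induction rule: complex_vector.span_induct_alt)
    case base
    then show ?case by (simp add: bounded_clinear_zero[OF bounded_clinear_gaussian_product])
  next
    case (step c x y)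
    \<comment> \<open>Spanning vectors suffice: each factor doubles the vacuum, and a vector with a
      creator in front is killed by \<open>?G\<close> and orthogonal to the vacuum.\<close>
    have "?G x = (2 ^ cdim TYPE('h) * cinner \<Omega> x) *\<^sub>C \<Omega>"
      using fock_set_cases[OF step(1)]
    proof (elim disjE exE conjE)
      assume "x = \<Omega>"
      then show ?thesis
        using gaussian_product_vacuum[OF onb, of "[0..<cdim TYPE('h)]" "\<lambda>j. 0"] cinner_vacuum
        by (simp add: atLeast0LessThan)
    next
      fix j z assume j: "j < cdim TYPE('h)" and x: "x = Zs (e j) z"
      then have "?G x = 0" using gaussian_product_zero_Zs[of "[0..<cdim TYPE('h)]" j z]
        by (simp add: atLeast0LessThan)
      moreover have "cinner \<Omega> x = 0" by (simp add: x cinner_Zs_right Z_vacuum)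
      ultimately show ?thesis by simp
    qed
    then show ?case
      using step(2)
      by (simp add: bounded_clinear_simps[OF bounded_clinear_gaussian_product] cinner_add_right
          cinner_scaleC_right scaleC_scaleC scaleC_add_left algebra_simps)
  qed
qed

lemma dim_fock: "of_nat (cdim TYPE('k)) = (2 ^ cdim TYPE('h) :: complex)"
proof -
  have "of_nat (cdim TYPE('k)) = trace_op (gaussian_product (\<lambda>j. 0) e [0..<cdim TYPE('h)])"
    by (rule trace_gaussian_product[OF onb, symmetric]) auto
  also have "\<dots> = trace_op (\<lambda>x. 2 ^ cdim TYPE('h) *\<^sub>C (cinner \<Omega> x *\<^sub>C \<Omega>))"
    by (simp add: gaussian_product_zero[abs_def] scaleC_scaleC)
  also have "\<dots> = 2 ^ cdim TYPE('h)"
    unfolding trace_scale trace_rank_one cinner_vacuum by simp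
  finally show ?thesis .
qed

text \<open>By cyclicity the anticommutation relation becomes an equation with the same trace on
  both sides, whence the 1/2.\<close>

lemma ntrace_Zs_Z: "ntrace Z (\<lambda>x. Zs \<psi> (Z \<phi> x)) = cinner \<phi> \<psi> / 2"
proof -
  let ?t = "trace_op (\<lambda>x. Zs \<psi> (Z \<phi> x))"
  have "?t = trace_op (\<lambda>x. Z \<phi> (Zs \<psi> x))"
    by (rule trace_commute[OF bounded_clinear_Zs bounded_clinear_Z])
  also have "\<dots> = cinner \<phi> \<psi> * 2 ^ cdim TYPE('h) - ?t"
    by (simp add: Z_Zs trace_diff trace_scale trace_id dim_fock)
  finally show ?thesis by (simp add: ntrace_def field_simps)
qed

text \<open>The four-point trace \<open>?X\<close> is found by moving \<open>Z u\<close> once around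
  the cycle: rightwards by the anticommutation relations, then back by cyclicity. This yields a
  linear equation for \<open>?X\<close>.\<close>

lemma ntrace_gaussian_factor_Zs_Z:
  assumes u: "cinner u u = 1"
  shows "ntrace Z (\<lambda>x. gaussian_factor Z p u (Zs \<psi> (Z \<phi> x))) = cinner \<phi> (one_mode_symbol p u \<psi>)"
proof -
  let ?X = "ntrace Z (\<lambda>x. Zs u (Z u (Zs \<psi> (Z \<phi> x))))"
  have "trace_op (\<lambda>x. (Zs u \<circ> Zs \<psi> \<circ> Z \<phi>) (Z u x)) = trace_op (\<lambda>x. Z u ((Zs u \<circ> Zs \<psi> \<circ> Z \<phi>) x))"
    by (intro trace_commute bounded_clinear_compose bounded_clinear_Zs bounded_clinear_Z)
  then have "trace_op (\<lambda>x. Zs u (Zs \<psi> (Z \<phi> (Z u x))))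
      = trace_op (\<lambda>x. Zs \<psi> (Z \<phi> x)) - trace_op (\<lambda>x. Zs u (Z u (Zs \<psi> (Z \<phi> x))))"
    using u by (simp add: Z_Zs[of u u] trace_diff)
  then have 1: "ntrace Z (\<lambda>x. Zs u (Zs \<psi> (Z \<phi> (Z u x)))) = cinner \<phi> \<psi> / 2 - ?X"
    using ntrace_Zs_Z[of \<psi> \<phi>] by (simp add: ntrace_def diff_divide_distrib)
  have "Zs u (Z u (Zs \<psi> (Z \<phi> x))) = cinner u \<psi> *\<^sub>C Zs u (Z \<phi> x) + Zs u (Zs \<psi> (Z \<phi> (Z u x)))" for x
    by (simp add: Z_Zs[of u \<psi>] Z_anticommute[of u \<phi>] Zs_simps)
  then have "?X = cinner u \<psi> * ntrace Z (\<lambda>x. Zs u (Z \<phi> x))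
      + ntrace Z (\<lambda>x. Zs u (Zs \<psi> (Z \<phi> (Z u x))))"
    by (simp only: ntrace_def trace_add trace_scale add_divide_distrib times_divide_eq_right)
  then have "?X = cinner u \<psi> * (cinner \<phi> u / 2) + (cinner \<phi> \<psi> / 2 - ?X)"
    unfolding 1 ntrace_Zs_Z .
  then have X: "?X = cinner u \<psi> * cinner \<phi> u / 4 + cinner \<phi> \<psi> / 4"
    by (simp add: field_simps)
  \<comment> \<open>Normal ordering the factor leaves only the two-point trace and
    \<open>?X\<close>.\<close>
  have "gaussian_factor Z p u y = of_real (2 * (1 - p)) *\<^sub>C y + of_real (4 * p - 2) *\<^sub>C Zs u (Z u y)" for y
  proof -
    have "gaussian_factor Z p u y = of_real (2 * (1 - p)) *\<^sub>C y
        + (of_real (2 * p) *\<^sub>C Zs u (Z u y) - of_real (2 * (1 - p)) *\<^sub>C Zs u (Z u y))"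
      using u by (simp add: gaussian_factor_def Z_Zs mult.commute complex_vector.scale_right_diff_distrib)
    then show ?thesis
      by (simp only: complex_vector.scale_left_diff_distrib[symmetric] of_real_diff[symmetric])
        (simp add: algebra_simps)
  qed
  then have "ntrace Z (\<lambda>x. gaussian_factor Z p u (Zs \<psi> (Z \<phi> x)))
      = of_real (2 * (1 - p)) * (cinner \<phi> \<psi> / 2) + of_real (4 * p - 2) * ?X"
    unfolding ntrace_Zs_Z[symmetric]
    by (simp only: ntrace_def trace_add trace_scale add_divide_distrib times_divide_eq_right)
  also have "\<dots> = cinner \<phi> (one_mode_symbol p u \<psi>)"
    unfolding X by (simp add: one_mode_symbol_def cinner_add_right cinner_scaleC_right field_simps)
  finally show ?thesis .
qed

end

section \<open>The quantum operation\<close>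

lemma nonneg_Reals_sum:
  "(\<And>i. i \<in> I \<Longrightarrow> f i \<in> \<real>\<^sub>\<ge>\<^sub>0) \<Longrightarrow> (\<Sum>i\<in>I. f i :: complex) \<in> \<real>\<^sub>\<ge>\<^sub>0"
  by (induction I rule: infinite_finite_induct) (auto intro: nonneg_Reals_add_I)

text \<open>An instance of the Schur product theorem: a positive matrix times a Gram matrix, entry
  by entry. Expanding the Gram entries in the basis \<open>b\<close> turns the sum into block forms
  of \<open>M\<close> at the test vectors \<open>?a l\<close>.\<close>

lemma (in fock) block_positive_compress:
  fixes M :: "nat \<Rightarrow> nat \<Rightarrow> 'k \<Rightarrow> 'k" and w :: 'k and y :: "nat \<Rightarrow> 'k"
  assumes "block_positive n M" and M: "\<And>i j. i < n \<Longrightarrow> j < n \<Longrightarrow> bounded_clinear (M i j)"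
  shows "(\<Sum>i<n. \<Sum>j<n. cinner w (M i j w) * cinner (y i) (y j)) \<in> \<real>\<^sub>\<ge>\<^sub>0"
proof -
  let ?a = "\<lambda>l i. cinner (b l) (y i) *\<^sub>C w"
  have "cinner w (M i j w) * cinner (y i) (y j) = (\<Sum>l<cdim TYPE('k). cinner (?a l i) (M i j (?a l j)))"
    if "i < n" "j < n" for i j
    unfolding parseval[OF onb_b, of "y i" "y j"] sum_distrib_left
    using cinner_commute[of "y i" "b _"]
    by (intro sum.cong) (simp_all add: bounded_clinear_scaleC[OF M[OF that]] cinner_scaleC_left
        cinner_scaleC_right mult_ac)
  then have "(\<Sum>i<n. \<Sum>j<n. cinner w (M i j w) * cinner (y i) (y j))
      = (\<Sum>i<n. \<Sum>j<n. \<Sum>l<cdim TYPE('k). cinner (?a l i) (M i j (?a l j)))"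
    by (intro sum.cong) simp_all
  also have "\<dots> = (\<Sum>l<cdim TYPE('k). \<Sum>i<n. \<Sum>j<n. cinner (?a l i) (M i j (?a l j)))"
    unfolding sum.swap[of _ "{..<cdim TYPE('k)}"] ..
  also have "\<dots> \<in> \<real>\<^sub>\<ge>\<^sub>0"
  proof (rule nonneg_Reals_sum)
    fix l
    show "(\<Sum>i<n. \<Sum>j<n. cinner (?a l i) (M i j (?a l j))) \<in> \<real>\<^sub>\<ge>\<^sub>0"
      using assms(1)[unfolded block_positive_def, rule_format, of "?a l"] .
  qed
  finally show ?thesis .
qed

context fock
begin

definition channel :: "'h \<Rightarrow> ('k \<Rightarrow> 'k) \<Rightarrow> 'k \<Rightarrow> 'k" where
  "channel u A x = (cinner \<Omega> (A \<Omega>) / 2 ^ cdim TYPE('h)) *\<^sub>C gaussian_factor Z 1 u x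
     + ((trace_op A - cinner \<Omega> (A \<Omega>)) / 2 ^ cdim TYPE('h)) *\<^sub>C gaussian_factor Z 0 u x"

text \<open>The right side is the trace of \<open>A\<close> compressed to the complement of the
  vacuum; \<open>b\<close> need not contain the vacuum, so its vectors are projected. This makes the
  second coefficient of \<open>channel\<close> a sum of diagonal expectations, as
  \<open>block_positive_compress\<close> requires.\<close>

lemma trace_minus_vacuum:
  assumes A: "bounded_clinear A"
  shows "trace_op A - cinner \<Omega> (A \<Omega>)
    = (\<Sum>k<cdim TYPE('k). cinner (b k - cinner \<Omega> (b k) *\<^sub>C \<Omega>) (A (b k - cinner \<Omega> (b k) *\<^sub>C \<Omega>)))"
proof -
  have "cinner (b k - cinner \<Omega> (b k) *\<^sub>C \<Omega>) (A (b k - cinner \<Omega> (b k) *\<^sub>C \<Omega>))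
      = cinner (b k) (A (b k)) - cinner \<Omega> (b k) * cinner (b k) (A \<Omega>)
        - cinner \<Omega> (A (b k)) * cinner (b k) \<Omega>
        + cinner \<Omega> (A \<Omega>) * (cinner \<Omega> (b k) * cinner (b k) \<Omega>)" for k
    using cinner_commute[of "b k" \<Omega>]
    by (simp add: bounded_clinear_simps[OF A] cinner_diff_left cinner_diff_right cinner_scaleC_left
        cinner_scaleC_right algebra_simps)
  moreover have "(\<Sum>k<cdim TYPE('k). cinner \<Omega> (A (b k)) * cinner (b k) \<Omega>) = cinner \<Omega> (A \<Omega>)"
    using parseval[OF onb_b, of "adj A \<Omega>" \<Omega>] by (simp add: cinner_adj_left[OF A])
  ultimately show ?thesis
    by (simp add: sum.distrib sum_subtractf sum_distrib_left[symmetric] parseval[OF onb_b, symmetric]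
        trace_eq[symmetric] cinner_vacuum)
qed

text \<open>Each entry is a sum of expectations of \<open>M i j\<close> times Gram entries: the
  vacuum is paired with the vectors \<open>Z u (x i)\<close>, the projected basis vectors with
  \<open>Zs u (x i)\<close>.\<close>

lemma completely_positive_channel: "completely_positive_on (CAR_algebra Z) (channel u)"
  unfolding completely_positive_on_def
proof (intro allI impI)
  fix n M assume M: "\<forall>i<n. \<forall>j<n. M i j \<in> CAR_algebra Z" and pos: "block_positive n M"
  have bcl: "bounded_clinear (M i j)" if "i < n" "j < n" for i j
    using M that by (simp add: CAR_algebra_bounded_clinear)
  let ?w = "\<lambda>k. b k - cinner \<Omega> (b k) *\<^sub>C \<Omega>"
  \<comment> \<open>The numerator 2 comes from the Gaussian factors, the denominator from the
    normalization of the trace.\<close>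
  let ?c = "complex_of_real (2 / 2 ^ cdim TYPE('h))"
  have c: "?c \<in> \<real>\<^sub>\<ge>\<^sub>0" by (intro iffD2[OF nonneg_Reals_of_real_iff]) simp
  show "block_positive n (\<lambda>i j. channel u (M i j))"
    unfolding block_positive_def
  proof
    fix x :: "nat \<Rightarrow> 'k"
    let ?f = "\<lambda>w y. \<Sum>i<n. \<Sum>j<n. cinner w (M i j w) * cinner (y i) (y j)"
    have entry: "cinner (x i) (channel u (M i j) (x j))
        = ?c * (cinner \<Omega> (M i j \<Omega>) * cinner (Z u (x i)) (Z u (x j))
          + (\<Sum>k<cdim TYPE('k). cinner (?w k) (M i j (?w k)) * cinner (Zs u (x i)) (Zs u (x j))))"
      if "i < n" "j < n" for i j
      unfolding channel_def trace_minus_vacuum[OF bcl[OF that]] cinner_add_right cinner_scaleC_right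
        cinner_gaussian_factor_1 cinner_gaussian_factor_0 sum_distrib_right[symmetric]
      by (simp add: field_simps)
    have "(\<Sum>i<n. \<Sum>j<n. cinner (x i) (channel u (M i j) (x j)))
        = (\<Sum>i<n. \<Sum>j<n. ?c * (cinner \<Omega> (M i j \<Omega>) * cinner (Z u (x i)) (Z u (x j))
          + (\<Sum>k<cdim TYPE('k). cinner (?w k) (M i j (?w k)) * cinner (Zs u (x i)) (Zs u (x j)))))"
      by (intro sum.cong refl) (simp only: entry lessThan_iff)
    also have "\<dots> = ?c * (?f \<Omega> (\<lambda>i. Z u (x i))
        + (\<Sum>k<cdim TYPE('k). ?f (?w k) (\<lambda>i. Zs u (x i))))"
      unfolding sum.swap[of _ _ "{..<cdim TYPE('k)}"]
      by (simp only: sum_distrib_left[symmetric] sum.distrib)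
    also have "\<dots> \<in> \<real>\<^sub>\<ge>\<^sub>0"
      using c by (intro nonneg_Reals_mult_I nonneg_Reals_add_I nonneg_Reals_sum
          block_positive_compress pos bcl)
    finally show "(\<Sum>i<n. \<Sum>j<n. cinner (x i) (channel u (M i j) (x j))) \<in> \<real>\<^sub>\<ge>\<^sub>0" .
  qed
qed

lemma ntrace_channel:
  assumes u: "cinner u u = 1"
  shows "ntrace Z (channel u A) = ntrace Z A"
proof -
  \<comment> \<open>Both prepared operators have trace \<open>2 ^ N\<close>, which cancels the
    denominators of the coefficients.\<close>
  have gf: "trace_op (gaussian_factor Z m u) = 2 ^ cdim TYPE('h)" for m
    using trace_gaussian_factor[OF bounded_clinear_id _ u, of m] by (simp add: trace_id dim_fock)
  have "trace_op (channel u A) = trace_op A"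
    unfolding channel_def[abs_def] trace_add trace_scale gf by (simp add: field_simps)
  then show ?thesis by (simp add: ntrace_def)
qed

lemma quantum_operation_channel:
  assumes u: "cinner u u = 1"
  shows "quantum_operation Z (channel u)"
  unfolding quantum_operation_def
proof (intro conjI ballI allI completely_positive_channel ntrace_channel[OF u])
  have "(\<lambda>x. a *\<^sub>C gaussian_factor Z 1 u x + c *\<^sub>C gaussian_factor Z 0 u x) \<in> CAR_algebra Z" for a c
    using gaussian_factor_in_CAR_algebra unfolding CAR_algebra_def
    by (intro star_algebra.add star_algebra.scale)
  then show "channel u ` CAR_algebra Z \<subseteq> CAR_algebra Z"
    by (auto simp: channel_def[abs_def])
next
  fix A B :: "'k \<Rightarrow> 'k"
  show "channel u (\<lambda>x. A x + B x) = (\<lambda>x. channel u A x + channel u B x)"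
    by (simp add: fun_eq_iff channel_def trace_add cinner_add_right add_divide_distrib
        diff_divide_distrib complex_vector.scale_left_distrib complex_vector.scale_left_diff_distrib)
next
  fix c and A :: "'k \<Rightarrow> 'k"
  have "(c * t - c * s) / r = c * ((t - s) / r)" for t s r :: complex
    by (simp add: right_diff_distrib)
  then show "channel u (\<lambda>x. c *\<^sub>C A x) = (\<lambda>x. c *\<^sub>C channel u A x)"
    by (intro ext) (simp only: channel_def trace_scale cinner_scaleC_right scaleC_add_right scaleC_scaleC
        times_divide_eq_right)
qed

text \<open>This equals \<open>det (1 - Q)\<close>.\<close>

definition vacuum_weight :: "('h \<Rightarrow> 'h) \<Rightarrow> real" where
  "vacuum_weight Q = Re (cinner \<Omega> (gaussian_state Z Q \<Omega>)) / 2 ^ cdim TYPE('h)"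

text \<open>Keeps the weight together with the decomposition that produced it, so that bounds and
  special values follow from its eigenvalues.\<close>

lemma gaussian_state_vacuum_weight:
  assumes fin: "finite_cdim TYPE('h)" and Q: "Q \<in> symbols"
  shows "\<exists>\<mu> \<psi>. spectral_decomposition Q \<mu> \<psi> \<and> vacuum_weight Q = (\<Prod>j<cdim TYPE('h). 1 - \<mu> j) \<and>
    cinner \<Omega> (gaussian_state Z Q \<Omega>) = 2 ^ cdim TYPE('h) * of_real (vacuum_weight Q) \<and>
    trace_op (gaussian_state Z Q) = 2 ^ cdim TYPE('h)"
proof -
  let ?N = "cdim TYPE('h)"
  have "positive_op Q" using Q by (simp add: symbols_def)
  then obtain \<mu> \<psi> where sd: "spectral_decomposition Q \<mu> \<psi>"
    and gs: "gaussian_state Z Q = gaussian_product \<mu> \<psi> [0..<?N]"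
    using gaussian_state_product[OF fin] by blast
  have \<psi>: "orthonormal_basis \<psi>" using sd by (simp add: spectral_decomposition_def)
  have "gaussian_state Z Q \<Omega> = of_real (\<Prod>j\<in>set [0..<?N]. 2 * (1 - \<mu> j)) *\<^sub>C \<Omega>"
    unfolding gs by (rule gaussian_product_vacuum[OF \<psi>]) auto
  then have "cinner \<Omega> (gaussian_state Z Q \<Omega>) = of_real (\<Prod>j<?N. 2 * (1 - \<mu> j))"
    by (simp only: cinner_scaleC_right cinner_vacuum mult_1_right set_upt atLeast0LessThan)
  also have "(\<Prod>j<?N. 2 * (1 - \<mu> j)) = 2 ^ ?N * (\<Prod>j<?N. 1 - \<mu> j)"
    unfolding prod.distrib by simp
  finally have v: "cinner \<Omega> (gaussian_state Z Q \<Omega>) = of_real (2 ^ ?N * (\<Prod>j<?N. 1 - \<mu> j))" .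
  then have w: "vacuum_weight Q = (\<Prod>j<?N. 1 - \<mu> j)"
    unfolding vacuum_weight_def v Re_complex_of_real by simp
  have "trace_op (gaussian_state Z Q) = 2 ^ ?N"
    unfolding gs dim_fock[symmetric] by (rule trace_gaussian_product[OF \<psi>]) auto
  moreover have "cinner \<Omega> (gaussian_state Z Q \<Omega>) = 2 ^ ?N * of_real (vacuum_weight Q)"
    unfolding v w of_real_mult by simp
  ultimately show ?thesis using sd w by blast
qed

lemma vacuum_weight_bounds:
  assumes fin: "finite_cdim TYPE('h)" and Q: "Q \<in> symbols"
  shows "0 \<le> vacuum_weight Q" "vacuum_weight Q \<le> 1"
proof -
  obtain \<mu> \<psi> where sd: "spectral_decomposition Q \<mu> \<psi>"
    and w: "vacuum_weight Q = (\<Prod>j<cdim TYPE('h). 1 - \<mu> j)"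
    using gaussian_state_vacuum_weight[OF fin Q] by blast
  note bounds = symbol_eigenvalue_bounds[OF Q sd]
  show "0 \<le> vacuum_weight Q" unfolding w using bounds by (intro prod_nonneg) simp
  show "vacuum_weight Q \<le> 1" unfolding w using bounds by (intro prod_le_1) simp
qed

section \<open>The symbol map and its values at multiples of the identity\<close>

lemma channel_gaussian_state:
  assumes fin: "finite_cdim TYPE('h)" and Q: "Q \<in> symbols"
  shows "channel u (gaussian_state Z Q) = gaussian_factor Z (vacuum_weight Q) u"
proof
  fix x
  let ?p = "complex_of_real (vacuum_weight Q)" and ?D = "2 ^ cdim TYPE('h) :: complex"
  have v: "cinner \<Omega> (gaussian_state Z Q \<Omega>) = ?D * ?p" and t: "trace_op (gaussian_state Z Q) = ?D"
    using gaussian_state_vacuum_weight[OF fin Q] by blast+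
  have "?D * ?p / ?D = ?p" "(?D - ?D * ?p) / ?D = of_real (1 - vacuum_weight Q)"
    by (simp_all add: field_simps)
  then show "channel u (gaussian_state Z Q) x = gaussian_factor Z (vacuum_weight Q) u x"
    unfolding channel_def v t gaussian_factor_interpolate[of "vacuum_weight Q" u x] by simp
qed

lemma symbol_map_channel:
  assumes fin: "finite_cdim TYPE('h)" and u: "cinner u u = 1" and Q: "Q \<in> symbols"
  shows "symbol_map Z (channel u) Q = one_mode_symbol (vacuum_weight Q) u"
proof -
  have eq: "ntrace Z (channel u (gaussian_state Z Q) \<circ> Zs \<psi> \<circ> Z \<phi>)
      = cinner \<phi> (one_mode_symbol (vacuum_weight Q) u \<psi>)" for \<phi> \<psi>
    using ntrace_gaussian_factor_Zs_Z[OF u] by (simp add: channel_gaussian_state[OF fin Q] comp_def)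
  show ?thesis
    unfolding symbol_map_def eq
  proof (rule the_equality)
    fix G assume "bounded_clinear G \<and>
      (\<forall>\<phi> \<psi>. cinner \<phi> (G \<psi>) = cinner \<phi> (one_mode_symbol (vacuum_weight Q) u \<psi>))"
    then show "G = one_mode_symbol (vacuum_weight Q) u"
      by (intro ext cinner_extensionality) blast
  qed (simp add: bounded_clinear_one_mode_symbol)
qed

text \<open>A multiple of the identity has only the eigenvalue \<open>c\<close>, whichever
  eigenbasis is chosen.\<close>

lemma vacuum_weight_scaleR:
  assumes fin: "finite_cdim TYPE('h)" and Q: "(\<lambda>x :: 'h. c *\<^sub>R x) \<in> symbols"
  shows "vacuum_weight (\<lambda>x. c *\<^sub>R x) = (1 - c) ^ cdim TYPE('h)"
proof -
  obtain \<mu> \<psi> where sd: "spectral_decomposition (\<lambda>x :: 'h. c *\<^sub>R x) \<mu> \<psi>"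
    and w: "vacuum_weight (\<lambda>x. c *\<^sub>R x) = (\<Prod>j<cdim TYPE('h). 1 - \<mu> j)"
    using gaussian_state_vacuum_weight[OF fin Q] by blast
  have "\<mu> j = c" if j: "j < cdim TYPE('h)" for j
  proof -
    have "cinner (\<psi> j) (\<psi> j) = 1"
      using sd j by (simp add: spectral_decomposition_def orthonormal_basis_def)
    then have "\<psi> j \<noteq> 0" by auto
    moreover have "c *\<^sub>R \<psi> j = \<mu> j *\<^sub>R \<psi> j"
      using spectral_decomposition_eigenvector[OF sd j] by (simp add: scaleC_of_real)
    ultimately show ?thesis by simp
  qed
  then show ?thesis unfolding w by simp
qed

end

lemma scaleR_in_symbols:
  assumes "0 \<le> c" "c \<le> 1"
  shows "(\<lambda>x :: 'h::complex_hilbert_space. c *\<^sub>R x) \<in> symbols"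
proof -
  have pos: "positive_op (\<lambda>x :: 'h. r *\<^sub>R x)" if "0 \<le> r" for r
    unfolding positive_op_def
  proof (intro conjI allI)
    show "bounded_clinear (\<lambda>x :: 'h. r *\<^sub>R x)"
      unfolding scaleR_scaleC by (rule bounded_clinear_scale[OF bounded_clinear_id])
    fix x :: 'h
    have "cinner x (r *\<^sub>R x) = of_real (r * (norm x)\<^sup>2)"
      by (simp add: scaleR_scaleC cinner_scaleC_right cinner_norm)
    then show "cinner x (r *\<^sub>R x) \<in> \<real>\<^sub>\<ge>\<^sub>0"
      using that by (simp only: nonneg_Reals_of_real_iff) simp
  qed
  have "(\<lambda>x :: 'h. x - c *\<^sub>R x) = (\<lambda>x. (1 - c) *\<^sub>R x)"
    by (simp add: algebra_simps)
  then show ?thesis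
    using pos[of c] pos[of "1 - c"] assms by (simp add: symbols_def)
qed

text \<open>Midpoint test between the symbols \<open>0\<close> and \<open>1\<close>: there \<open>det (1 - Q)\<close> takes the values \<open>1\<close>,
  \<open>0\<close>, and \<open>2 ^ -N\<close> at the midpoint.\<close>

theorem theorem1p19:
  fixes Z :: "'h::complex_hilbert_space \<Rightarrow> 'k::complex_hilbert_space \<Rightarrow> 'k"
  assumes "finite_cdim TYPE('h)" and "cdim TYPE('h) \<ge> 2"
    and "CAR_field Z" and "acts_irreducibly Z"
  shows "\<exists>\<Phi>. quantum_operation Z \<Phi> \<and>
           \<Phi> ` GIG_states Z \<subseteq> GIG_states Z \<and>
           symbol_map Z \<Phi> \<in> symbols \<rightarrow> symbols \<and>
           \<not> affine_on_symbols (symbol_map Z \<Phi>)"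
proof -
  let ?N = "cdim TYPE('h)"
  note fin = assms(1)
  obtain e :: "nat \<Rightarrow> 'h" where e: "orthonormal_basis e"
    using orthonormal_basis_exists[OF fin] by blast
  interpret car_field Z by unfold_locales (rule assms(3))
  obtain \<Omega> where "norm \<Omega> = 1" "\<forall>\<psi>. Z \<psi> \<Omega> = 0"
    using vacuum_exists[OF e] assms(4) by (auto simp: acts_irreducibly_def)
  then interpret fock Z e \<Omega>
    using assms(4) e by unfold_locales auto
  define u where "u = e 0"
  have uu: "cinner u u = 1" using onb_eq[of 0 0] assms(2) by (simp add: u_def)
  then have u: "norm u = 1" by (simp only: norm_eq_1_iff_cinner)
  let ?\<Phi> = "channel u" and ?\<gamma> = "\<lambda>Q. one_mode_symbol (vacuum_weight Q) u"
  have \<gamma>: "?\<gamma> Q \<in> symbols" if "Q \<in> symbols" for Q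
    using vacuum_weight_bounds[OF fin that] by (intro one_mode_symbol_in_symbols u)
  have "?\<Phi> (gaussian_state Z Q) \<in> GIG_states Z" if Q: "Q \<in> symbols" for Q
  proof -
    have "?\<Phi> (gaussian_state Z Q) = gaussian_state Z (?\<gamma> Q)"
      using vacuum_weight_bounds(1)[OF fin Q]
      by (simp add: channel_gaussian_state[OF fin Q] gaussian_state_one_mode[OF fin u])
    then show ?thesis using \<gamma>[OF Q] by (simp add: GIG_states_def)
  qed
  then have "?\<Phi> ` GIG_states Z \<subseteq> GIG_states Z" by (auto simp: GIG_states_def)
  moreover have "symbol_map Z ?\<Phi> \<in> symbols \<rightarrow> symbols"
    using \<gamma> by (simp add: symbol_map_channel[OF fin uu])
  moreover have "\<not> affine_on_symbols (symbol_map Z ?\<Phi>)"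
  proof
    assume aff: "affine_on_symbols (symbol_map Z ?\<Phi>)"
    have sym: "(\<lambda>x :: 'h. 0 *\<^sub>R x) \<in> symbols" "(\<lambda>x :: 'h. 1 *\<^sub>R x) \<in> symbols"
      "(\<lambda>x :: 'h. (1/2) *\<^sub>R x) \<in> symbols"
      by (rule scaleR_in_symbols; simp)+
    \<comment> \<open>The diagonal entry at \<open>u\<close> of a one-mode symbol is its parameter,
      \<open>1/2 + (p - 1/2)\<close>.\<close>
    have val: "cinner u (symbol_map Z ?\<Phi> (\<lambda>x. c *\<^sub>R x) u) = of_real ((1 - c) ^ ?N)"
      if "(\<lambda>x :: 'h. c *\<^sub>R x) \<in> symbols" for c
      unfolding symbol_map_channel[OF fin uu that] vacuum_weight_scaleR[OF fin that]
      by (simp add: one_mode_symbol_def cinner_add_right cinner_scaleC_right uu)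
    have half: "(1/2 :: real) \<in> {0..1}" by simp
    have "symbol_map Z ?\<Phi> (\<lambda>x. (1/2) *\<^sub>R 0 *\<^sub>R x + (1 - 1/2) *\<^sub>R 1 *\<^sub>R x)
        = (\<lambda>x. (1/2) *\<^sub>R symbol_map Z ?\<Phi> (\<lambda>x. 0 *\<^sub>R x) x + (1 - 1/2) *\<^sub>R symbol_map Z ?\<Phi> (\<lambda>x. 1 *\<^sub>R x) x)"
      using aff[unfolded affine_on_symbols_def, rule_format, OF sym(1,2) half] .
    moreover have "(\<lambda>x :: 'h. (1/2) *\<^sub>R 0 *\<^sub>R x + (1 - 1/2) *\<^sub>R 1 *\<^sub>R x) = (\<lambda>x. (1/2) *\<^sub>R x)"
      by simp
    ultimately have "cinner u (symbol_map Z ?\<Phi> (\<lambda>x. (1/2) *\<^sub>R x) u)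
        = of_real (1/2) * cinner u (symbol_map Z ?\<Phi> (\<lambda>x. 0 *\<^sub>R x) u)
          + of_real (1 - 1/2) * cinner u (symbol_map Z ?\<Phi> (\<lambda>x. 1 *\<^sub>R x) u)"
      by (simp only: cinner_add_right scaleR_scaleC[of "1/2" "symbol_map _ _ _ _"]
          scaleR_scaleC[of "1 - 1/2" "symbol_map _ _ _ _"] cinner_scaleC_right)
    \<comment> \<open>The endpoint value \<open>0 ^ ?N\<close> vanishes since \<open>?N\<close> is
      positive. At \<open>?N = 1\<close> the two sides would agree; \<open>?N \<ge> 2\<close> brings
      the left one down to at most 1/4.\<close>
    then have "complex_of_real ((1/2) ^ ?N) = of_real (1/2)"
      unfolding val[OF sym(1)] val[OF sym(2)] val[OF sym(3)] using assms(2) by simp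
    then have "(1/2 :: real) ^ ?N = 1/2" by (simp only: of_real_eq_iff)
    moreover have "(1/2 :: real) ^ ?N \<le> (1/2) ^ 2"
      using assms(2) by (intro power_decreasing) auto
    ultimately show False by (simp add: power2_eq_square)
  qed
  ultimately show ?thesis using quantum_operation_channel[OF uu] by blast
qed

end
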